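(* Let $1<p<\infty$ and let $\{\lambda_n\}_{n=1}^\infty\in\mathrm{GBV}$ satisfy $$\sum_{n=1}^\infty n^{p-2}\lambda_n^p<\infty .$$ Let $f(x)=\sum_{n=1}^\infty\lambda_n\cos nx$. Then there is a constant $C>0$ (depending on $\{\lambda_n\}$ and $p$ but not on $n$) such that for every $n\ge1$, $$\omega(f,n^{-1})_{L^p}\le C n^{-1}\Big(\sum_{k=1}^{n-1}k^{2p-2}\lambda_k^p\Big)^{1/p}+C\Big(\sum_{k=n}^\infty k^{p-2}\lambda_k^p\Big)^{1/p}.$$
   Context: $\Delta c_n:=c_n-c_{n+1}$. A sequence $\mathbf c=\{c_n\}_{n=1}^\infty$ belongs to the class $\mathrm{GBV}$ if $c_n\ge 0$ for all $n$, $c_n\to 0$ as $n\to\infty$, and there is a positive constant $M(\mathbf c)$ depending only on $\mathbf c$ such that $\sum_{n=m}^{2m}|\Delta c_n|\le M(\mathbf c)\,c_m$ for all $m=1,2,\dots$. $L^p$ denotes the space of $2\pi$-periodic functions whose $p$-th power is integrable over a period, and $\omega(f,t)_{L^p}=\sup_{0<h\le t}\|f(\cdot+h)-f(\cdot)\|_{L^p[0,2\pi]}$ is the $L^p$ modulus of continuity. An empty sum (the case $n=1$) is $0$. *)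

theory Defs
  imports "HOL-Analysis.Analysis"
begin

text \<open>Sequences are indexed by positive naturals; the value at index 0 is ignored.\<close>

definition GBV :: "(nat \<Rightarrow> real) \<Rightarrow> bool" where
  "GBV c \<longleftrightarrow> (\<forall>n\<ge>1. c n \<ge> 0) \<and> (c \<longlonglongrightarrow> 0) \<and>
     (\<exists>M>0. \<forall>m\<ge>1. (\<Sum>n=m..2*m. \<bar>c n - c (Suc n)\<bar>) \<le> M * c m)"

definition cos_series :: "(nat \<Rightarrow> real) \<Rightarrow> real \<Rightarrow> real" where
  "cos_series c x = (\<Sum>n. c (Suc n) * cos (real (Suc n) * x))"

definition Lp_norm :: "real \<Rightarrow> (real \<Rightarrow> real) \<Rightarrow> real" where
  "Lp_norm p g = (LINT x:{0..2*pi}|lborel. \<bar>g x\<bar> powr p) powr (1/p)"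

definition Lp_modulus :: "real \<Rightarrow> (real \<Rightarrow> real) \<Rightarrow> real \<Rightarrow> real" where
  "Lp_modulus p f t = Sup {Lp_norm p (\<lambda>x. f (x + h) - f x) | h. 0 < h \<and> h \<le> t}"

end

theory Submission
  imports Defs
begin

text \<open>
  Cut the frequencies into dyadic blocks. On a block of length \<open>b\<close>, Abel summation and the GBV condition
  bound the trigonometric sum by a constant times \<open>A * min b (1 / \<bar>sin (x / 2)\<bar>)\<close>, where \<open>A\<close> is
  controlled by the coefficient at the left end of the block. A Schur test, carried out pointwise by
  Jensen's inequality, shows that the \<open>p\<close>-th power of the \<open>L^p\<close> norm of a sum of such blocks is at most a
  constant times \<open>\<Sum>j. A j powr p * b j powr (p - 1)\<close>, and GBV allows each of these terms to be averaged
  over the preceding block.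

  The partial sums of \<open>f (x + h) - f x\<close> with \<open>h \<le> 1 / n\<close> are split at frequency \<open>n\<close>. Frequencies at
  least \<open>n\<close> are estimated in \<open>f (x + h)\<close> and \<open>f x\<close> separately. Below \<open>n\<close> the increment is itself a sine
  polynomial in \<open>x + h / 2\<close> with coefficients \<open>2 lam k sin (k h / 2)\<close>, to which the same block estimate
  applies. All bounds are uniform in the length of the partial sum, so Fatou's lemma gives the theorem.
\<close>

section \<open>A Hardy-type inequality for dyadic kernels\<close>

text \<open>
  This is \<open>min b (1 / \<bar>x\<bar>)\<close>, written so that it has the right value \<open>b\<close> at \<open>x = 0\<close>, where
  the quotient would be a junk value.
\<close>

definition kern :: "real \<Rightarrow> real \<Rightarrow> real" where
  "kern b x = b / max 1 (b * \<bar>x\<bar>)"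

lemma kern_nonneg: "0 \<le> b \<Longrightarrow> 0 \<le> kern b x"
  by (simp add: kern_def)

lemma kern_measurable [measurable]: "kern b \<in> borel_measurable borel"
  unfolding kern_def by measurable

lemma kern_scale: "kern b x = b * kern 1 (b * x)" if "0 < b"
  using that by (simp add: kern_def abs_mult)

lemma kern_eq: "kern b x = min (b * \<bar>x\<bar>) 1 / \<bar>x\<bar>" if "0 < b" "x \<noteq> 0"
  using that by (auto simp: kern_def min_def max_def)

lemma kern_le_inverse: "kern b x \<le> 1 / \<bar>x\<bar>" if "0 < b" "x \<noteq> 0"
  using that by (simp add: kern_eq divide_right_mono)

lemma geometric_sum_le: "(\<Sum>i<n. (1/r) ^ i) \<le> r / (r - 1)" if "1 < r" for r :: real
proof -
  have "(\<Sum>i<n. (1/r) ^ i) \<le> (\<Sum>i. (1/r) ^ i)"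
    using that by (intro sum_le_suminf summable_geometric) auto
  also have "\<dots> = r / (r - 1)"
    using that by (subst suminf_geometric) (auto simp: field_simps)
  finally show ?thesis .
qed

text \<open>The terms grow with \<open>j\<close>, so the active ones form an initial segment. Its
  last term is at most 1, and read backwards the segment is dominated by a geometric series of ratio
  \<open>1/r\<close>.\<close>

lemma sum_increasing_powers_le:
  fixes r y :: real
  assumes "1 < r" "0 < y"
  shows "(\<Sum>j<n. if y * r ^ j \<le> 1 then y * r ^ j else 0) \<le> r / (r - 1)"
proof (induction n)
  case 0
  then show ?case using assms by simp
next
  case (Suc n)
  show ?case
  proof (cases "y * r ^ n \<le> 1")
    case False
    then show ?thesis using Suc by simp
  next
    case True
    have "(\<Sum>j<Suc n. if y * r ^ j \<le> 1 then y * r ^ j else 0) \<le> (\<Sum>j<Suc n. y * r ^ j)"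
      using assms by (intro sum_mono) auto
    also have "\<dots> = y * r ^ n * (\<Sum>j<Suc n. (1/r) ^ j)"
      unfolding sum_distrib_left
      by (subst sum.nat_diff_reindex[symmetric], intro sum.cong)
         (use assms in \<open>auto simp: power_diff power_divide field_simps\<close>)
    also have "\<dots> \<le> 1 * (r / (r - 1))"
      using True assms by (intro mult_mono geometric_sum_le sum_nonneg) auto
    finally show ?thesis by simp
  qed
qed

text \<open>While \<open>y \<le> 1\<close> the first term vanishes and a factor \<open>r\<close> is
  absorbed into \<open>y\<close>, which is why the induction generalizes \<open>y\<close>. Once
  \<open>1 < y\<close>, term \<open>j\<close> is at most \<open>(1/r) ^ j\<close>.\<close>

lemma sum_decreasing_powers_le:
  fixes r y :: real
  assumes "1 < r" "0 < y"
  shows "(\<Sum>j<n. if 1 < y * r ^ j then 1 / (y * r ^ j) else 0) \<le> r / (r - 1)"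
  using assms(2)
proof (induction n arbitrary: y)
  case 0
  then show ?case using assms by simp
next
  case (Suc n)
  show ?case
  proof (cases "1 < y")
    case False
    have "(\<Sum>j<Suc n. if 1 < y * r ^ j then 1 / (y * r ^ j) else 0)
      = (\<Sum>j<n. if 1 < (y * r) * r ^ j then 1 / ((y * r) * r ^ j) else 0)"
      using False by (subst sum.lessThan_Suc_shift) (auto simp: mult.assoc intro!: sum.cong)
    also have "\<dots> \<le> r / (r - 1)"
      using Suc assms by (intro Suc.IH) auto
    finally show ?thesis .
  next
    case True
    have "(\<Sum>j<Suc n. if 1 < y * r ^ j then 1 / (y * r ^ j) else 0)
       \<le> (\<Sum>j<Suc n. (1/r) ^ j)"
    proof (intro sum_mono)
      fix j
      have "1 / (y * r ^ j) \<le> (1/r)^j"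
        using True assms by (simp add: power_divide divide_simps)
      then show "(if 1 < y * r ^ j then 1 / (y * r ^ j) else 0) \<le> (1/r) ^ j"
        using assms by auto
    qed
    also have "\<dots> \<le> r / (r - 1)"
      using assms by (intro geometric_sum_le)
    finally show ?thesis .
  qed
qed

text \<open>
  The exponent \<open>1/p - 1\<close> is the Schur weight that makes the sum over all dyadic scales comparable
  to a power of \<open>x\<close>: the summand decays geometrically away from the scale \<open>b 2^j = 1 / \<bar>x\<bar>\<close>.
\<close>

lemma kern_weights_sum:
  fixes p :: real
  assumes "1 < p"
  shows "\<exists>D>0. \<forall>b>0. \<forall>x. x \<noteq> 0 \<longrightarrow> (\<forall>J::nat.
    (\<Sum>j<J. kern (b * 2 ^ j) x * (b * 2 ^ j) powr (1/p - 1)) \<le> D * \<bar>x\<bar> powr (- (1/p)))"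
proof -
  \<comment> \<open>These are the factors by which \<open>y powr (1/p)\<close> and
    \<open>y powr (1 - 1/p)\<close> grow when \<open>y = b * 2 ^ j * \<bar>x\<bar>\<close> doubles;
    \<open>1 < p\<close> makes both exceed 1.\<close>
  define r s where "r = 2 powr (1/p)" and "s = 2 powr (1 - 1/p)"
  have rs: "1 < r" "1 < s" using assms by (auto simp: r_def s_def)
  show ?thesis
  proof (rule exI[of _ "r / (r - 1) + s / (s - 1)"], intro conjI allI impI)
    show "0 < r / (r - 1) + s / (s - 1)"
      using rs by (intro add_pos_pos) auto
    fix b x :: real and J :: nat
    assume b: "0 < b" and x: "x \<noteq> 0"
    define u v where "u = (b * \<bar>x\<bar>) powr (1/p)" and "v = (b * \<bar>x\<bar>) powr (1 - 1/p)"
    have uv: "0 < u" "0 < v" using b x by (auto simp: u_def v_def)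
    \<comment> \<open>For \<open>y \<le> 1\<close> the kernel equals its height
      \<open>b * 2 ^ j\<close>, otherwise \<open>1 / \<bar>x\<bar>\<close>. The case distinction is
      phrased through the powers of \<open>y\<close> so that the two geometric bounds apply with
      starting values \<open>u\<close> and \<open>v\<close>.\<close>
    have *: "kern (b * 2 ^ j) x * (b * 2 ^ j) powr (1/p - 1)
      = \<bar>x\<bar> powr (- (1/p)) * ((if u * r ^ j \<le> 1 then u * r ^ j else 0)
         + (if 1 < v * s ^ j then 1 / (v * s ^ j) else 0))" for j
    proof -
      define y where "y = b * 2 ^ j * \<bar>x\<bar>"
      have y: "0 < y" using b x by (simp add: y_def)
      have pj: "(2 powr a) ^ j = (2 ^ j) powr a" for a :: real
        by (simp add: powr_power powr_powr mult.commute powr_realpow[symmetric])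
      have ur: "u * r ^ j = y powr (1/p)" and vs: "v * s ^ j = y powr (1 - 1/p)"
        unfolding u_def v_def r_def s_def y_def pj using b
        by (simp_all add: powr_mult mult_ac)
      have c1: "y powr (1/p) \<le> 1 \<longleftrightarrow> y \<le> 1"
      proof -
        have "0 < 1/p" using assms by simp
        then show ?thesis using y
          by (smt (verit) powr_less_mono2 powr_mono2 powr_one_eq_one)
      qed
      have c2: "1 < y powr (1 - 1/p) \<longleftrightarrow> 1 < y"
      proof -
        have "0 < 1 - 1/p" using assms by simp
        then show ?thesis using y
          by (smt (verit) powr_less_mono2 powr_mono2 powr_one_eq_one)
      qed
      have "b * 2 ^ j = y / \<bar>x\<bar>" using x by (simp add: y_def)
      then have "kern (b * 2 ^ j) x * (b * 2 ^ j) powr (1/p - 1)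
         = min y 1 / \<bar>x\<bar> * (y / \<bar>x\<bar>) powr (1/p - 1)"
        using b x by (subst kern_eq) (auto simp: y_def)
      also have "\<dots> = min y 1 * y powr (1/p - 1) * (\<bar>x\<bar> powr (-1) / \<bar>x\<bar> powr (1/p - 1))"
        using y x by (simp add: powr_divide powr_minus divide_simps)
      also have "\<bar>x\<bar> powr (-1) / \<bar>x\<bar> powr (1/p - 1) = \<bar>x\<bar> powr (- (1/p))"
        by (subst powr_diff[symmetric]) simp
      also have "min y 1 * y powr (1/p - 1) = (if y powr (1/p) \<le> 1 then y powr (1/p) else 0)
         + (if 1 < y powr (1 - 1/p) then 1 / y powr (1 - 1/p) else 0)"
        unfolding c1 c2 using y by (auto simp: min_def powr_diff)
      finally show ?thesis by (simp add: ur vs mult_ac)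
    qed
    have "(\<Sum>j<J. kern (b * 2 ^ j) x * (b * 2 ^ j) powr (1/p - 1))
      = \<bar>x\<bar> powr (- (1/p)) * ((\<Sum>j<J. if u * r ^ j \<le> 1 then u * r ^ j else 0)
         + (\<Sum>j<J. if 1 < v * s ^ j then 1 / (v * s ^ j) else 0))"
      unfolding * by (simp add: sum_distrib_left sum.distrib distrib_left)
    also have "\<dots> \<le> \<bar>x\<bar> powr (- (1/p)) * (r / (r - 1) + s / (s - 1))"
      by (intro mult_left_mono add_mono sum_increasing_powers_le sum_decreasing_powers_le rs uv) auto
    finally show "(\<Sum>j<J. kern (b * 2 ^ j) x * (b * 2 ^ j) powr (1/p - 1))
       \<le> (r / (r - 1) + s / (s - 1)) * \<bar>x\<bar> powr (- (1/p))" by (simp add: mult_ac)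
  qed
qed

text \<open>Jensen's inequality for \<open>t powr p\<close> with the weights normalized by their
  sum; clearing the normalization leaves the exponent \<open>p - 1\<close>.\<close>

lemma powr_weighted_sum_le:
  fixes w y :: "'a \<Rightarrow> real" and p :: real
  assumes "1 < p" "finite S" "\<And>i. i \<in> S \<Longrightarrow> 0 \<le> w i" "\<And>i. i \<in> S \<Longrightarrow> 0 \<le> y i"
  shows "(\<Sum>i\<in>S. w i * y i) powr p \<le> (\<Sum>i\<in>S. w i) powr (p - 1) * (\<Sum>i\<in>S. w i * y i powr p)"
proof -
  \<comment> \<open>Convexity is applied on the open half-line, so zero values are dropped, and zero
    weights too, which makes the total weight positive. Dropped terms vanish on the left and are
    nonnegative on the right.\<close>
  define T where "T = {i\<in>S. 0 < w i \<and> 0 < y i}"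
  have T: "finite T" "T \<subseteq> S" using assms by (auto simp: T_def)
  have eq: "(\<Sum>i\<in>S. w i * y i) = (\<Sum>i\<in>T. w i * y i)"
    using assms by (intro sum.mono_neutral_right) (force simp: T_def)+
  show ?thesis
  proof (cases "T = {}")
    case True
    then show ?thesis using assms eq by (auto intro!: mult_nonneg_nonneg sum_nonneg)
  next
    case False
    define W where "W = (\<Sum>i\<in>T. w i)"
    have W: "0 < W" unfolding W_def using False T by (intro sum_pos) (auto simp: T_def)
    have "(\<Sum>i\<in>T. (w i / W) *\<^sub>R y i) powr p \<le> (\<Sum>i\<in>T. w i / W * y i powr p)"
      using False T W assms(1)
      by (intro convex_on_sum[of T "{0<..}" "\<lambda>x. x powr p"] powr_convex)
         (auto simp: T_def W_def sum_divide_distrib[symmetric] intro!: divide_nonneg_pos)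
    moreover have "(\<Sum>i\<in>T. (w i / W) *\<^sub>R y i) = (\<Sum>i\<in>T. w i * y i) / W"
      by (simp add: sum_divide_distrib)
    moreover have "(\<Sum>i\<in>T. w i / W * y i powr p) = (\<Sum>i\<in>T. w i * y i powr p) / W"
      by (simp add: sum_divide_distrib)
    moreover have "0 \<le> (\<Sum>i\<in>T. w i * y i)" by (intro sum_nonneg) (auto simp: T_def)
    ultimately have "(\<Sum>i\<in>T. w i * y i) powr p / W powr p \<le> (\<Sum>i\<in>T. w i * y i powr p) / W"
      using W by (simp add: powr_divide)
    then have "(\<Sum>i\<in>T. w i * y i) powr p \<le> W powr (p - 1) * (\<Sum>i\<in>T. w i * y i powr p)"
      using W by (simp add: powr_diff field_simps)
    also have "\<dots> \<le> (\<Sum>i\<in>S. w i) powr (p - 1) * (\<Sum>i\<in>S. w i * y i powr p)"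
      unfolding W_def using T assms W[unfolded W_def]
      by (intro mult_mono powr_mono2 sum_mono2 sum_nonneg) (auto intro!: mult_nonneg_nonneg sum_nonneg)
    finally show ?thesis unfolding eq .
  qed
qed

text \<open>The integrand is \<open>\<bar>x\<bar> powr (1/p - 1)\<close> near 0 and
  \<open>\<bar>x\<bar> powr (1/p - 2)\<close> far out; for \<open>1 < p\<close> the first exponent
  lies above -1 and the second below.\<close>

lemma nn_integral_kern_powr_finite:
  fixes p :: real
  assumes "1 < p"
  shows "(\<integral>\<^sup>+x. ennreal (kern 1 x * \<bar>x\<bar> powr (1/p - 1)) \<partial>lborel) < \<infinity>"
proof -
  let ?s = "1/p - 1"
  have s: "-1 < ?s" "?s < 0" using assms by auto
  \<comment> \<open>A majorant on the nonnegative half-line; negative arguments are covered by its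
    mirror image.\<close>
  let ?f = "\<lambda>x::real. ennreal (x powr ?s) * indicator {0..1} x + ennreal (x powr (?s - 1)) * indicator {1..} x"
  have "(\<integral>\<^sup>+x. ?f x \<partial>lborel) = ennreal (1 powr (?s+1) / (?s+1)) + ennreal (- (1 powr (?s-1+1)) / (?s-1+1))"
    using s
    by (subst nn_integral_add)
       (auto simp: nn_integral_has_integral_lebesgue'[OF _ has_integral_powr_from_0]
          nn_integral_has_integral_lebesgue'[OF _ has_integral_powr_to_inf])
  then have fin: "(\<integral>\<^sup>+x. ?f x \<partial>lborel) < \<infinity>" by simp
  have refl: "(\<integral>\<^sup>+x. ?f (0 + (-1) * x) \<partial>lborel) = (\<integral>\<^sup>+x. ?f x \<partial>lborel)"
    by (subst nn_integral_real_affine[where c = "-1" and t = 0 and f = ?f]) auto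
  have "(\<integral>\<^sup>+x. ennreal (kern 1 x * \<bar>x\<bar> powr ?s) \<partial>lborel) \<le> (\<integral>\<^sup>+x. ?f x + ?f (0 + (-1) * x) \<partial>lborel)"
  proof (intro nn_integral_mono)
    fix x :: real
    have *: "kern 1 y * \<bar>y\<bar> powr ?s \<le> (if y \<le> 1 then y powr ?s else y powr (?s - 1))" if "0 \<le> y" for y
      using that powr_diff[of y "1/p - 1" 1] by (auto simp: kern_def max_def)
    have "ennreal (kern 1 y * \<bar>y\<bar> powr ?s) \<le> ?f y" if "0 \<le> y" for y
    proof -
      have "ennreal (kern 1 y * \<bar>y\<bar> powr ?s) \<le> ennreal (if y \<le> 1 then y powr ?s else y powr (?s - 1))"
        by (intro ennreal_leI * that)
      also have "\<dots> \<le> ?f y"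
        using that by (cases "y \<le> 1") (simp_all add: indicator_def)
      finally show ?thesis .
    qed
    from this[of "\<bar>x\<bar>"] show "ennreal (kern 1 x * \<bar>x\<bar> powr ?s) \<le> ?f x + ?f (0 + (-1) * x)"
      by (cases "0 \<le> x") (auto simp: kern_def intro: order_trans)
  qed
  also have "\<dots> = (\<integral>\<^sup>+x. ?f x \<partial>lborel) + (\<integral>\<^sup>+x. ?f x \<partial>lborel)"
    by (subst nn_integral_add) (auto simp only: refl, auto)
  also have "\<dots> < \<infinity>" using fin by simp
  finally show ?thesis .
qed

text \<open>Substituting \<open>b * x\<close> for \<open>x\<close> reduces to \<open>b = 1\<close>;
  the homogeneity of the integrand leaves the factor \<open>b powr (1 - 1/p)\<close>.\<close>

lemma nn_integral_kern_powr:
  fixes p :: real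
  assumes "1 < p"
  shows "\<exists>K>0. \<forall>b>0. (\<integral>\<^sup>+x. ennreal (kern b x * \<bar>x\<bar> powr (1/p - 1)) \<partial>lborel) \<le> ennreal (K * b powr (1 - 1/p))"
proof -
  let ?s = "1/p - 1"
  let ?I = "\<integral>\<^sup>+x. ennreal (kern 1 x * \<bar>x\<bar> powr ?s) \<partial>lborel"
  define K where "K = enn2real ?I"
  have K: "?I = ennreal K" "0 \<le> K"
    using nn_integral_kern_powr_finite[OF assms] by (auto simp: K_def)
  show ?thesis
  proof (rule exI[of _ "K + 1"], intro conjI allI impI)
    show "0 < K + 1" using K by simp
    fix b :: real assume b: "0 < b"
    have "(\<integral>\<^sup>+x. ennreal (kern b x * \<bar>x\<bar> powr ?s) \<partial>lborel)
      = (\<integral>\<^sup>+x. ennreal (b powr (- ?s)) * (ennreal b * ennreal (kern 1 (0 + b * x) * \<bar>0 + b * x\<bar> powr ?s)) \<partial>lborel)"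
    proof (intro nn_integral_cong)
      fix x :: real
      have "b powr (- ?s) * b powr ?s = 1" using b by (subst powr_add[symmetric]) simp
      then have "kern b x * \<bar>x\<bar> powr ?s = b powr (- ?s) * (b * (kern 1 (0 + b * x) * \<bar>0 + b * x\<bar> powr ?s))"
        using b by (subst kern_scale) (simp_all add: abs_mult powr_mult mult_ac del: minus_diff_eq)
      then show "ennreal (kern b x * \<bar>x\<bar> powr ?s)
        = ennreal (b powr (- ?s)) * (ennreal b * ennreal (kern 1 (0 + b * x) * \<bar>0 + b * x\<bar> powr ?s))"
        using b by (simp only: ennreal_mult'[symmetric] powr_ge_zero less_imp_le)
    qed
    also have "\<dots> = ennreal (b powr (- ?s)) * (ennreal b * (\<integral>\<^sup>+x. ennreal (kern 1 (0 + b * x) * \<bar>0 + b * x\<bar> powr ?s) \<partial>lborel))"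
      by (simp add: nn_integral_cmult)
    also have "ennreal b * (\<integral>\<^sup>+x. ennreal (kern 1 (0 + b * x) * \<bar>0 + b * x\<bar> powr ?s) \<partial>lborel) = ?I"
      using b by (subst nn_integral_real_affine[where c = b and t = 0]) auto
    also have "ennreal (b powr (- ?s)) * ?I = ennreal (K * b powr (1 - 1/p))"
      by (simp add: K ennreal_mult'[symmetric] mult.commute)
    also have "\<dots> \<le> ennreal ((K + 1) * b powr (1 - 1/p))"
      by (intro ennreal_leI mult_right_mono) auto
    finally show "(\<integral>\<^sup>+x. ennreal (kern b x * \<bar>x\<bar> powr ?s) \<partial>lborel) \<le> ennreal ((K + 1) * b powr (1 - 1/p))" .
  qed
qed

text \<open>The Schur test. With \<open>q = 1 - 1/p\<close>, each term is split as
  \<open>(kern (c j) x * c j powr (- q)) * (A j * c j powr q)\<close>. Jensen isolates the sum of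
  the first factors, which is at most \<open>D * \<bar>x\<bar> powr (- (1/p))\<close>; what remains
  is integrated scale by scale, and the exponents add up through
  \<open>q * (p - 1) + q = p - 1\<close>.\<close>

lemma nn_integral_kern_sum:
  fixes p :: real
  assumes p: "1 < p"
  shows "\<exists>E>0. \<forall>b>0. \<forall>(J::nat) A. (\<forall>j. 0 \<le> A j) \<longrightarrow>
     (\<integral>\<^sup>+x. ennreal ((\<Sum>j<J. A j * kern (b * 2 ^ j) x) powr p) \<partial>lborel)
       \<le> ennreal (E * (\<Sum>j<J. A j powr p * (b * 2 ^ j) powr (p - 1)))"
proof -
  obtain D where D: "0 < D" and
    WD: "\<And>b x (J::nat). 0 < b \<Longrightarrow> x \<noteq> 0 \<Longrightarrow>
    (\<Sum>j<J. kern (b * 2 ^ j) x * (b * 2 ^ j) powr (1/p - 1)) \<le> D * \<bar>x\<bar> powr (- (1/p))"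
    using kern_weights_sum[OF p] by blast
  obtain K where K: "0 < K" and
    KI: "\<And>b. 0 < b \<Longrightarrow> (\<integral>\<^sup>+x. ennreal (kern b x * \<bar>x\<bar> powr (1/p - 1)) \<partial>lborel) \<le> ennreal (K * b powr (1 - 1/p))"
    using nn_integral_kern_powr[OF p] by blast
  show ?thesis
  proof (rule exI[of _ "D powr (p - 1) * K"], intro conjI allI impI)
    show "0 < D powr (p - 1) * K" using D K by simp
    fix b :: real and J :: nat and A :: "nat \<Rightarrow> real"
    assume b: "0 < b" and A: "\<forall>j. 0 \<le> A j"
    define q where "q = 1 - 1/p"
    define c where "c j = b * 2 ^ j" for j
    have c: "0 < c j" for j using b by (simp add: c_def)
    define B where "B j = A j powr p * c j powr (q * (p - 1))" for j
    have B: "0 \<le> B j" for j by (simp add: B_def)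
    have ptw: "(\<Sum>j<J. A j * kern (c j) x) powr p
       \<le> D powr (p - 1) * (\<Sum>j<J. B j * (kern (c j) x * \<bar>x\<bar> powr (1/p - 1)))" if x: "x \<noteq> 0" for x
    proof -
      have "(\<Sum>j<J. A j * kern (c j) x) powr p = (\<Sum>j<J. (kern (c j) x * c j powr (- q)) * (A j * c j powr q)) powr p"
        using c by (intro arg_cong[where f = "\<lambda>z. z powr p"] sum.cong) (auto simp: powr_minus less_imp_neq[symmetric])
      also have "\<dots> \<le> (\<Sum>j<J. kern (c j) x * c j powr (- q)) powr (p - 1) *
          (\<Sum>j<J. (kern (c j) x * c j powr (- q)) * (A j * c j powr q) powr p)"
        using p A c by (intro powr_weighted_sum_le) (auto intro!: mult_nonneg_nonneg kern_nonneg less_imp_le[OF c])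
      also have "(\<Sum>j<J. (kern (c j) x * c j powr (- q)) * (A j * c j powr q) powr p)
         = (\<Sum>j<J. B j * kern (c j) x)"
      proof (intro sum.cong refl)
        fix j
        have "c j powr (- q) * c j powr (q * p) = c j powr (q * (p - 1))"
          by (simp add: powr_add[symmetric] algebra_simps)
        then show "(kern (c j) x * c j powr (- q)) * (A j * c j powr q) powr p = B j * kern (c j) x"
          using A c by (simp add: B_def powr_mult powr_powr mult_ac)
      qed
      also have "(\<Sum>j<J. kern (c j) x * c j powr (- q)) powr (p - 1) * (\<Sum>j<J. B j * kern (c j) x)
         \<le> (D * \<bar>x\<bar> powr (- (1/p))) powr (p - 1) * (\<Sum>j<J. B j * kern (c j) x)"
        using WD[OF b x, of J] p c B
        by (intro mult_right_mono powr_mono2 sum_nonneg mult_nonneg_nonneg kern_nonneg)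
           (auto simp: c_def q_def intro!: sum_nonneg mult_nonneg_nonneg kern_nonneg less_imp_le)
      also have "(D * \<bar>x\<bar> powr (- (1/p))) powr (p - 1) = D powr (p - 1) * \<bar>x\<bar> powr (1/p - 1)"
      proof -
        have "- (1/p) * (p - 1) = 1/p - 1" using p by (simp add: field_simps)
        then show ?thesis using D by (simp add: powr_mult powr_powr)
      qed
      finally show ?thesis by (simp add: sum_distrib_left mult_ac)
    qed
    have "(\<integral>\<^sup>+x. ennreal ((\<Sum>j<J. A j * kern (c j) x) powr p) \<partial>lborel)
      \<le> (\<integral>\<^sup>+x. ennreal (D powr (p - 1) * (\<Sum>j<J. B j * (kern (c j) x * \<bar>x\<bar> powr (1/p - 1)))) \<partial>lborel)"
      \<comment> \<open>At \<open>x = 0\<close> the power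
        \<open>\<bar>x\<bar> powr (1/p - 1)\<close> has the value 0 and the pointwise bound need not
        hold, so this point is discarded as a null set.\<close>
      using AE_lborel_singleton[of "0::real"]
      by (intro nn_integral_mono_AE) (auto elim!: eventually_mono intro!: ennreal_leI ptw)
    also have "\<dots> = (\<integral>\<^sup>+x. ennreal (D powr (p - 1)) * (\<Sum>j<J. ennreal (B j) * ennreal (kern (c j) x * \<bar>x\<bar> powr (1/p - 1))) \<partial>lborel)"
      using B kern_nonneg[OF less_imp_le[OF c]]
      by (intro nn_integral_cong) (simp add: ennreal_mult'[symmetric])
    also have "\<dots> = ennreal (D powr (p - 1)) * (\<Sum>j<J. ennreal (B j) * (\<integral>\<^sup>+x. ennreal (kern (c j) x * \<bar>x\<bar> powr (1/p - 1)) \<partial>lborel))"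
      by (simp add: nn_integral_cmult nn_integral_sum)
    also have "\<dots> \<le> ennreal (D powr (p - 1)) * (\<Sum>j<J. ennreal (B j) * ennreal (K * c j powr q))"
      using KI[OF c] by (intro mult_left_mono sum_mono) (auto simp: q_def)
    also have "\<dots> = ennreal (D powr (p - 1) * (\<Sum>j<J. B j * (K * c j powr q)))"
      using B K by (simp add: ennreal_mult'[symmetric])
    also have "(\<Sum>j<J. B j * (K * c j powr q)) = K * (\<Sum>j<J. A j powr p * c j powr (p - 1))"
      unfolding sum_distrib_left
    proof (intro sum.cong refl)
      fix j
      have "q * (p - 1) + q = p - 1" using p by (simp add: q_def field_simps)
      then have "c j powr (q * (p - 1)) * c j powr q = c j powr (p - 1)"
        by (simp add: powr_add[symmetric])
      then show "B j * (K * c j powr q) = K * (A j powr p * c j powr (p - 1))"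
        by (simp add: B_def mult_ac)
    qed
    finally show "(\<integral>\<^sup>+x. ennreal ((\<Sum>j<J. A j * kern (b * 2 ^ j) x) powr p) \<partial>lborel)
       \<le> ennreal (D powr (p - 1) * K * (\<Sum>j<J. A j powr p * (b * 2 ^ j) powr (p - 1)))"
      by (simp add: c_def mult.assoc)
  qed
qed

section \<open>Dyadic blocks of trigonometric sums\<close>

lemma sum_by_parts:
  fixes a :: "nat \<Rightarrow> real" and z :: "nat \<Rightarrow> complex"
  assumes "u \<le> m"
  shows "(\<Sum>k\<in>{u..<Suc m}. of_real (a k) * z k)
    = of_real (a m) * sum z {u..<Suc m} + (\<Sum>k\<in>{u..<m}. of_real (a k - a (Suc k)) * sum z {u..<Suc k})"
  using assms
proof (induction m rule: dec_induct)
  case base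
  then show ?case by simp
next
  case (step m)
  then show ?case by (simp add: algebra_simps)
qed

text \<open>Multiplication by \<open>cis x - 1\<close> makes the sum telescope, and this factor has
  norm \<open>2 * \<bar>sin (x / 2)\<bar>\<close>. The product form stays meaningful where the sine
  vanishes.\<close>

lemma norm_sum_cis_le:
  "norm (\<Sum>k\<in>{u..<v}. cis (real k * x)) * \<bar>sin (x / 2)\<bar> \<le> 1"
proof (cases "u \<le> v")
  case False
  then show ?thesis by simp
next
  case True
  have "(\<Sum>k\<in>{u..<v}. cis (real k * x)) * (cis x - 1) = cis (real v * x) - cis (real u * x)"
    using True
  proof (induction v rule: dec_induct)
    case (step m)
    have "cis (real (Suc m) * x) = cis (real m * x) * cis x"
      by (simp add: cis_mult algebra_simps)
    then show ?case using step by (simp add: algebra_simps)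
  qed simp
  then have "norm (\<Sum>k\<in>{u..<v}. cis (real k * x)) * norm (cis x - 1) = norm (cis (real v * x) - cis (real u * x))"
    by (metis norm_mult)
  also have "\<dots> \<le> 2"
    using norm_triangle_ineq4[of "cis (real v * x)" "cis (real u * x)"] by simp
  finally show ?thesis
    using dist_exp_i_1[of x] by (simp add: cis_conv_exp)
qed

text \<open>Counting terms gives the bound \<open>b * A\<close>, Abel summation gives
  \<open>2 * A / \<bar>sin (x / 2)\<bar>\<close>, and the kernel encodes the better of the two up to
  constants. The separate variable \<open>w\<close> lets a representative of \<open>x\<close> modulo
  \<open>2 * pi\<close> be chosen later; it costs the factor \<open>pi\<close>.\<close>

lemma trig_block_le:
  fixes a :: "nat \<Rightarrow> real"
  assumes b: "0 < b" "real v - real u \<le> b" and A: "0 \<le> A"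
    and bound: "\<And>k. u \<le> k \<Longrightarrow> k < v \<Longrightarrow> \<bar>a k\<bar> \<le> A"
    and var: "(\<Sum>k\<in>{u..<v - 1}. \<bar>a k - a (Suc k)\<bar>) \<le> A"
    and w: "\<bar>w\<bar> \<le> pi * \<bar>sin (x / 2)\<bar>"
  shows "norm (\<Sum>k\<in>{u..<v}. of_real (a k) * cis (real k * x)) \<le> 2 * pi * A * kern b w"
proof (cases "u < v")
  case False
  then show ?thesis using A b by (auto intro!: mult_nonneg_nonneg kern_nonneg)
next
  case True
  define G where "G = norm (\<Sum>k\<in>{u..<v}. of_real (a k) * cis (real k * x))"
  define Z where "Z k = (\<Sum>i\<in>{u..<Suc k}. cis (real i * x))" for k
  define m where "m = v - 1"
  have m: "v = Suc m" "u \<le> m" using True by (auto simp: m_def)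
  have "G \<le> (\<Sum>k\<in>{u..<v}. \<bar>a k\<bar>)"
    unfolding G_def by (rule order_trans[OF norm_sum]) (simp add: norm_mult)
  also have "\<dots> \<le> (\<Sum>k\<in>{u..<v}. A)"
    using bound by (intro sum_mono) auto
  also have "\<dots> = (real v - real u) * A" using True by simp
  also have "\<dots> \<le> b * A" using b A by (intro mult_right_mono) auto
  finally have G1: "G \<le> b * A" .
  have "G \<le> \<bar>a m\<bar> * norm (Z m) + (\<Sum>k\<in>{u..<m}. \<bar>a k - a (Suc k)\<bar> * norm (Z k))"
    unfolding G_def m(1) sum_by_parts[OF m(2)] Z_def[symmetric]
    by (intro order_trans[OF norm_triangle_ineq] add_mono order_trans[OF norm_sum])
       (auto simp: norm_mult simp del: of_real_diff)
  then have "G * \<bar>sin (x/2)\<bar> \<le> (\<bar>a m\<bar> * norm (Z m) + (\<Sum>k\<in>{u..<m}. \<bar>a k - a (Suc k)\<bar> * norm (Z k))) * \<bar>sin (x/2)\<bar>"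
    by (intro mult_right_mono) auto
  also have "\<dots> = \<bar>a m\<bar> * (norm (Z m) * \<bar>sin (x/2)\<bar>)
      + (\<Sum>k\<in>{u..<m}. \<bar>a k - a (Suc k)\<bar> * (norm (Z k) * \<bar>sin (x/2)\<bar>))"
    by (simp add: distrib_right sum_distrib_right mult.assoc)
  also have "\<dots> \<le> \<bar>a m\<bar> * 1 + (\<Sum>k\<in>{u..<m}. \<bar>a k - a (Suc k)\<bar> * 1)"
    unfolding Z_def by (intro add_mono mult_left_mono sum_mono norm_sum_cis_le) auto
  also have "\<dots> \<le> 2 * A" using bound[of m] var m by auto
  finally have "pi * (G * \<bar>sin (x/2)\<bar>) \<le> pi * (2 * A)" by (intro mult_left_mono) auto
  moreover have "G * \<bar>w\<bar> \<le> G * (pi * \<bar>sin (x/2)\<bar>)"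
    using w by (intro mult_left_mono) (auto simp: G_def)
  ultimately have "G * \<bar>w\<bar> \<le> 2 * pi * A"
    using mult.left_commute[of G pi "\<bar>sin (x/2)\<bar>"] by linarith
  then have "G * (b * \<bar>w\<bar>) \<le> 2 * pi * A * b"
    using b mult_left_mono[of "G * \<bar>w\<bar>" "2 * pi * A" b] by (simp add: mult_ac)
  moreover have "G * 1 \<le> 2 * pi * A * b"
  proof -
    have "1 * (b * A) \<le> (2 * pi) * (b * A)"
      using b A pi_gt3 by (intro mult_right_mono) auto
    then show ?thesis using G1 by (simp add: mult_ac)
  qed
  \<comment> \<open>Both bounds now have the same right side, so they merge into one with the
    maximum that is the denominator of the kernel.\<close>
  ultimately have "G * max 1 (b * \<bar>w\<bar>) \<le> 2 * pi * A * b"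
    by (auto simp: max_def)
  then show ?thesis
    by (simp add: kern_def G_def[symmetric] pos_le_divide_eq max.strict_coboundedI1)
qed

text \<open>Truncating with \<open>min\<close> keeps the identity exact for every \<open>N\<close>:
  the block containing \<open>N\<close> is cut off and later ones are empty.\<close>

lemma sum_dyadic_blocks:
  fixes f :: "nat \<Rightarrow> 'a::comm_monoid_add"
  shows "sum f {n..<min (n * 2 ^ J) N} = (\<Sum>j<J. sum f {n * 2 ^ j..<min (n * 2 ^ Suc j) N})"
proof (induction J)
  case 0
  then show ?case by simp
next
  case (Suc J)
  have "sum f {n..<min (n * 2 ^ Suc J) N}
     = sum f {n..<min (n * 2 ^ J) N} + sum f {n * 2 ^ J..<min (n * 2 ^ Suc J) N}"
  proof (cases "n * 2 ^ J \<le> N")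
    case True
    have le: "n \<le> n * 2 ^ J" "n * 2 ^ J \<le> n * 2 ^ Suc J" by auto
    show ?thesis using True le
      by (subst sum.atLeastLessThan_concat[symmetric, of n "n * 2 ^ J"]) auto
  next
    case False
    then have "N \<le> n * 2 ^ Suc J" "N \<le> n * 2 ^ J" by auto
    then show ?thesis by (simp add: min_absorb2)
  qed
  then show ?case using Suc by simp
qed

text \<open>Block \<open>j\<close> has length at most \<open>n * 2 ^ j\<close>, which becomes the
  height of its kernel. All blocks share the same \<open>w\<close>, so the majorant has the shape
  required by the Schur test.\<close>

lemma trig_sum_le:
  fixes a :: "nat \<Rightarrow> real"
  assumes n: "0 < n" and N: "N \<le> n * 2 ^ J" and A: "\<And>j. 0 \<le> A j"
    and bound: "\<And>j k. n * 2 ^ j \<le> k \<Longrightarrow> k < min (n * 2 ^ Suc j) N \<Longrightarrow> \<bar>a k\<bar> \<le> A j"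
    and var: "\<And>j. (\<Sum>k\<in>{n * 2 ^ j..<min (n * 2 ^ Suc j) N - 1}. \<bar>a k - a (Suc k)\<bar>) \<le> A j"
    and w: "\<bar>w\<bar> \<le> pi * \<bar>sin (x / 2)\<bar>"
  shows "norm (\<Sum>k\<in>{n..<N}. of_real (a k) * cis (real k * x))
    \<le> (\<Sum>j<J. (2 * pi * A j) * kern (real n * 2 ^ j) w)"
proof -
  have "(\<Sum>k\<in>{n..<N}. of_real (a k) * cis (real k * x))
     = (\<Sum>j<J. \<Sum>k\<in>{n * 2 ^ j..<min (n * 2 ^ Suc j) N}. of_real (a k) * cis (real k * x))"
    using sum_dyadic_blocks[of "\<lambda>k. of_real (a k) * cis (real k * x)" n J N] N
    by (simp add: min_absorb2)
  also have "norm \<dots> \<le> (\<Sum>j<J. (2 * pi * A j) * kern (real n * 2 ^ j) w)"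
  proof (rule order_trans[OF norm_sum], rule sum_mono)
    fix j
    have "real (min (n * 2 ^ Suc j) N) \<le> real (n * 2 ^ Suc j)" by linarith
    then show "norm (\<Sum>k\<in>{n * 2 ^ j..<min (n * 2 ^ Suc j) N}. of_real (a k) * cis (real k * x))
        \<le> (2 * pi * A j) * kern (real n * 2 ^ j) w"
      using n by (intro trig_block_le A bound var w) auto
  qed
  finally show ?thesis .
qed

lemma cos_sum_le:
  assumes "norm (\<Sum>k\<in>S. of_real (a k) * cis (real k * x)) \<le> B"
  shows "\<bar>\<Sum>k\<in>S. a k * cos (real k * x)\<bar> \<le> B"
  using abs_Re_le_cmod[of "\<Sum>k\<in>S. of_real (a k) * cis (real k * x)"] assms by simp

lemma sin_sum_le:
  assumes "norm (\<Sum>k\<in>S. of_real (a k) * cis (real k * x)) \<le> B"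
  shows "\<bar>\<Sum>k\<in>S. a k * sin (real k * x)\<bar> \<le> B"
  using abs_Im_le_cmod[of "\<Sum>k\<in>S. of_real (a k) * cis (real k * x)"] assms by simp

text \<open>Jordan's inequality: by concavity the sine lies above its chord from 0 to
  \<open>pi/2\<close>.\<close>

lemma sin_half_lower:
  assumes "\<bar>u\<bar> \<le> pi"
  shows "\<bar>u\<bar> \<le> pi * \<bar>sin (u / 2)\<bar>"
proof -
  define s where "s = \<bar>u\<bar> / pi"
  have s: "0 \<le> s" "s \<le> 1" using assms by (auto simp: s_def divide_simps)
  have "concave_on {0..pi} (sin :: real \<Rightarrow> real)"
    by (rule f''_le0_imp_concave[where f' = cos and f'' = "\<lambda>x. - sin x"])
       (auto intro!: derivative_eq_intros sin_ge_zero)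
  from concave_onD[OF this, of s 0 "pi/2"] s have "s \<le> sin (s * (pi / 2))"
    by simp
  also have "s * (pi / 2) = \<bar>u\<bar> / 2" by (simp add: s_def)
  also have "sin (\<bar>u\<bar> / 2) \<le> \<bar>sin (u / 2)\<bar>" by (cases "0 \<le> u") auto
  finally show ?thesis by (simp add: s_def divide_simps mult_ac)
qed

text \<open>
  A function bounded in terms of \<open>sin (x / 2)\<close> is dominated on a shifted period by a function of the
  distance to the nearest of the two points \<open>0\<close> and \<open>2 * pi\<close>, whence the factor 2.
\<close>

lemma nn_integral_period_le:
  fixes g :: "real \<Rightarrow> real" and p :: real
  assumes p: "1 < p" and t: "0 \<le> t" "t \<le> 1"
    and dom: "\<And>x w. \<bar>w\<bar> \<le> pi * \<bar>sin (x / 2)\<bar> \<Longrightarrow> \<bar>g x\<bar> \<le> (\<Sum>j<J. A j * kern (b * 2 ^ j) w)"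
    and int: "(\<integral>\<^sup>+x. ennreal ((\<Sum>j<J. A j * kern (b * 2 ^ j) x) powr p) \<partial>lborel) \<le> ennreal R"
  shows "(\<integral>\<^sup>+x. ennreal (\<bar>g (x + t)\<bar> powr p) * indicator {0..2*pi} x \<partial>lborel) \<le> ennreal (2 * R)"
proof -
  define G where "G x = ennreal ((\<Sum>j<J. A j * kern (b * 2 ^ j) x) powr p)" for x
  have [measurable]: "G \<in> borel_measurable borel" unfolding G_def by measurable
  have shift: "(\<integral>\<^sup>+x. G (s + 1 * x) \<partial>lborel) = (\<integral>\<^sup>+x. G x \<partial>lborel)" for s
    using nn_integral_real_affine[of G 1 s] by simp
  have "(\<integral>\<^sup>+x. ennreal (\<bar>g (x + t)\<bar> powr p) * indicator {0..2*pi} x \<partial>lborel)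
     \<le> (\<integral>\<^sup>+x. G (t + 1 * x) + G ((t - 2 * pi) + 1 * x) \<partial>lborel)"
  proof (intro nn_integral_mono)
    fix x :: real
    show "ennreal (\<bar>g (x + t)\<bar> powr p) * indicator {0..2*pi} x \<le> G (t + 1 * x) + G ((t - 2 * pi) + 1 * x)"
    proof (cases "x \<in> {0..2*pi}")
      case True
      have le: "ennreal (\<bar>g (x + t)\<bar> powr p) \<le> G w" if "\<bar>w\<bar> \<le> pi * \<bar>sin ((x + t) / 2)\<bar>" for w
        unfolding G_def using dom[OF that] p by (intro ennreal_leI powr_mono2) auto
      show ?thesis
      proof (cases "x + t \<le> pi")
        case le_pi: True
        then have "ennreal (\<bar>g (x + t)\<bar> powr p) \<le> G (x + t)"
          using True t by (intro le sin_half_lower) auto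
        then show ?thesis using True by (auto simp: add_ac intro: order_trans)
      next
        case False
        have "\<bar>sin ((x + t - 2 * pi) / 2)\<bar> = \<bar>sin ((x + t) / 2)\<bar>"
          by (simp add: diff_divide_distrib sin_diff)
        \<comment> \<open>Here \<open>x + t - 2 * pi\<close> lies between \<open>- pi\<close> and
          \<open>t\<close>, and \<open>t \<le> 1 < pi\<close>.\<close>
        moreover have "\<bar>x + t - 2 * pi\<bar> \<le> pi" using True False t pi_gt3 by auto
        ultimately have "ennreal (\<bar>g (x + t)\<bar> powr p) \<le> G (x + t - 2 * pi)"
          using sin_half_lower[of "x + t - 2 * pi"] by (intro le) simp
        then show ?thesis using True by (auto simp: algebra_simps intro: order_trans)
      qed
    qed simp
  qed
  also have "\<dots> = (\<integral>\<^sup>+x. G x \<partial>lborel) + (\<integral>\<^sup>+x. G x \<partial>lborel)"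
    by (subst nn_integral_add) (simp_all only: shift, simp_all)
  also have "\<dots> \<le> ennreal R + ennreal R"
    using int by (intro add_mono) (auto simp: G_def)
  also have "\<dots> \<le> ennreal (2 * R)"
    by (cases "0 \<le> R") (auto simp: ennreal_plus[symmetric] ennreal_neg simp del: ennreal_plus)
  finally show ?thesis .
qed

section \<open>Sequences of generalized bounded variation\<close>

locale gbv_sequence =
  fixes p M :: real and c :: "nat \<Rightarrow> real"
  assumes p: "1 < p" and M: "0 < M"
    and nonneg: "1 \<le> n \<Longrightarrow> 0 \<le> c n"
    and variation: "1 \<le> m \<Longrightarrow> (\<Sum>n=m..2*m. \<bar>c n - c (Suc n)\<bar>) \<le> M * c m"
    and summable: "summable (\<lambda>n. real (Suc n) powr (p - 2) * c (Suc n) powr p)"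
begin

lemma variation_le:
  assumes "1 \<le> u" "v \<le> 2 * u + 1"
  shows "(\<Sum>k\<in>{u..<v}. \<bar>c k - c (Suc k)\<bar>) \<le> M * c u"
  using assms by (intro order_trans[OF sum_mono2 variation]) auto

text \<open>Telescoping turns the variation bound into a one-sided substitute for monotonicity:
  growth by at most the factor \<open>1 + M\<close> while the index at most doubles.\<close>

lemma le_doubling:
  assumes "1 \<le> k" "k \<le> n" "n \<le> 2 * k"
  shows "c n \<le> (1 + M) * c k"
proof -
  have "c n - c k = (\<Sum>i\<in>{k..<n}. c (Suc i) - c i)"
    using assms by (simp add: sum_Suc_diff')
  also have "\<dots> \<le> (\<Sum>i\<in>{k..<n}. \<bar>c i - c (Suc i)\<bar>)"
    by (intro sum_mono) auto
  also have "\<dots> \<le> M * c k" using assms by (intro variation_le) auto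
  finally show ?thesis by (simp add: algebra_simps)
qed

text \<open>For \<open>n/2 \<le> k < n\<close>, \<open>le_doubling\<close> bounds \<open>c n\<close>
  by \<open>c k\<close>, and \<open>n powr s\<close> is comparable to \<open>k powr s\<close> up to
  \<open>2 powr \<bar>s\<bar>\<close> for either sign of \<open>s\<close>. There are
  \<open>n div 2\<close> such \<open>k\<close>, at least \<open>n / 3\<close> of them, whence the
  3.\<close>

lemma averaging:
  "\<exists>C>0. \<forall>n\<ge>2. real n powr (s + 1) * c n powr p
     \<le> C * (\<Sum>k\<in>{(n + 1) div 2..<n}. real k powr s * c k powr p)"
proof (rule exI[of _ "3 * (2 powr \<bar>s\<bar> * (1 + M) powr p)"], intro conjI allI impI)
  let ?B = "2 powr \<bar>s\<bar> * (1 + M) powr p"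
  show "0 < 3 * ?B" using M by simp
  fix n :: nat assume n: "2 \<le> n"
  have *: "real n powr s * c n powr p \<le> ?B * (real k powr s * c k powr p)"
    if k: "k \<in> {(n + 1) div 2..<n}" for k
  proof -
    have k': "1 \<le> k" "k \<le> n" "n \<le> 2 * k" using k n by auto
    have "c n powr p \<le> ((1 + M) * c k) powr p"
      using le_doubling[OF k'] nonneg[of n] n p by (intro powr_mono2) auto
    also have "\<dots> = (1 + M) powr p * c k powr p"
      using M nonneg[OF k'(1)] by (simp add: powr_mult)
    finally have 1: "c n powr p \<le> (1 + M) powr p * c k powr p" .
    have "real n powr s \<le> 2 powr \<bar>s\<bar> * real k powr s"
    proof (cases "0 \<le> s")
      case True
      have "real n powr s \<le> (2 * real k) powr s"
        using True k' by (intro powr_mono2) auto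
      then show ?thesis using True by (simp add: powr_mult)
    next
      case False
      have "real n powr s \<le> real k powr s"
        using False k' by (intro powr_mono2') auto
      also have "\<dots> \<le> 2 powr \<bar>s\<bar> * real k powr s"
        using mult_right_mono[of 1 "2 powr \<bar>s\<bar>" "real k powr s"] by (simp add: ge_one_powr_ge_zero)
      finally show ?thesis .
    qed
    then have "real n powr s * c n powr p \<le> (2 powr \<bar>s\<bar> * real k powr s) * ((1 + M) powr p * c k powr p)"
      using 1 by (intro mult_mono) auto
    then show ?thesis by (simp add: mult_ac)
  qed
  have "real n / 3 * (real n powr s * c n powr p) \<le> real (n div 2) * (real n powr s * c n powr p)"
  proof (intro mult_right_mono)
    have "n \<le> 3 * (n div 2)" using n by presburger
    then show "real n / 3 \<le> real (n div 2)" by linarith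
  qed auto
  also have "\<dots> = (\<Sum>k\<in>{(n + 1) div 2..<n}. real n powr s * c n powr p)"
  proof -
    have "n - (n + 1) div 2 = n div 2" by presburger
    then show ?thesis by simp
  qed
  also have "\<dots> \<le> (\<Sum>k\<in>{(n + 1) div 2..<n}. ?B * (real k powr s * c k powr p))"
    by (intro sum_mono *)
  finally show "real n powr (s + 1) * c n powr p
     \<le> 3 * ?B * (\<Sum>k\<in>{(n + 1) div 2..<n}. real k powr s * c k powr p)"
    using n by (simp add: powr_add sum_distrib_left mult_ac)
qed

text \<open>Each term is charged to the preceding dyadic block, and these blocks are disjoint. The
  initial term has no predecessor and remains.\<close>

lemma dyadic_averaging:
  fixes F T :: "nat \<Rightarrow> real"
  assumes C: "\<And>j. T (Suc j) \<le> C * (\<Sum>k\<in>{n * 2 ^ j..<n * 2 ^ Suc j}. F k)"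
  shows "(\<Sum>j<Suc J. T j) \<le> T 0 + C * (\<Sum>k\<in>{n..<n * 2 ^ J}. F k)"
proof -
  have "(\<Sum>j<J. T (Suc j)) \<le> (\<Sum>j<J. C * (\<Sum>k\<in>{n * 2 ^ j..<n * 2 ^ Suc j}. F k))"
    by (intro sum_mono C)
  also have "\<dots> = C * (\<Sum>k\<in>{n..<n * 2 ^ J}. F k)"
  proof -
    have "(\<Sum>k\<in>{n * 2 ^ j..<min (n * 2 ^ Suc j) (n * 2 ^ J)}. F k) = (\<Sum>k\<in>{n * 2 ^ j..<n * 2 ^ Suc j}. F k)"
      if "j < J" for j
    proof -
      have "(2::nat) ^ Suc j \<le> 2 ^ J" using that by (intro power_increasing) auto
      then have "n * 2 ^ Suc j \<le> n * 2 ^ J" by (rule mult_le_mono2)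
      then show ?thesis by (simp add: min_absorb1)
    qed
    then show ?thesis
      using sum_dyadic_blocks[of F n J "n * 2 ^ J"]
      by (simp add: sum_distrib_left[symmetric] del: power_Suc)
  qed
  finally show ?thesis by (simp add: sum.lessThan_Suc_shift del: sum.lessThan_Suc)
qed

text \<open>Together with \<open>tail\<close>, this is one of the two sums in the theorem before
  taking roots.\<close>

definition head :: "nat \<Rightarrow> real" where
  "head n = (\<Sum>k=1..n-1. real k powr (2*p - 2) * c k powr p)"

definition tail :: "nat \<Rightarrow> real" where
  "tail n = (\<Sum>k. real (k + n) powr (p - 2) * c (k + n) powr p)"

lemma head_nonneg: "0 \<le> head n"
  by (simp add: head_def sum_nonneg)

lemma summable_tail: "summable (\<lambda>k. real (k + n) powr (p - 2) * c (k + n) powr p)"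
  using summable summable_iff_shift[of "\<lambda>k. real k powr (p - 2) * c k powr p" 1]
    summable_iff_shift[of "\<lambda>k. real k powr (p - 2) * c k powr p" n] by simp

lemma tail_nonneg: "0 \<le> tail n"
  unfolding tail_def by (intro suminf_nonneg summable_tail) auto

lemma sum_le_tail: "(\<Sum>k\<in>{n..<N}. real k powr (p - 2) * c k powr p) \<le> tail n"
proof (cases "n \<le> N")
  case True
  have "(\<Sum>k\<in>{n..<N}. real k powr (p - 2) * c k powr p)
     = (\<Sum>k<N - n. real (k + n) powr (p - 2) * c (k + n) powr p)"
    using True sum.shift_bounds_nat_ivl[of "\<lambda>k. real k powr (p - 2) * c k powr p" 0 n "N - n"]
    by (simp add: atLeast0LessThan)
  also have "\<dots> \<le> tail n"
    unfolding tail_def by (intro sum_le_suminf summable_tail) auto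
  finally show ?thesis .
next
  case False
  then show ?thesis using tail_nonneg by simp
qed

text \<open>
  Membership in GBV bounds \<open>c n\<close> only by values at smaller indices, so for the block starting at \<open>n\<close>
  itself the averaging reaches below \<open>n\<close> and has to be paid for by the head sum.
\<close>

lemma high_blocks:
  "\<exists>C>0. \<forall>n\<ge>1. \<forall>J. (\<Sum>j<J. c (n * 2 ^ j) powr p * (real n * 2 ^ j) powr (p - 1))
     \<le> C * (real n powr (- p) * head n + tail n)"
proof -
  \<comment> \<open>The exponent \<open>2 * p - 2\<close> matches the weights of \<open>head\<close>
    and serves the block starting at \<open>n\<close>; the exponent \<open>p - 2\<close> below
    matches \<open>tail\<close> and serves the later blocks.\<close>
  obtain C1 where C1: "0 < C1" "\<And>n. 2 \<le> n \<Longrightarrow> real n powr (2 * p - 2 + 1) * c n powr p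
     \<le> C1 * (\<Sum>k\<in>{(n + 1) div 2..<n}. real k powr (2 * p - 2) * c k powr p)"
    using averaging[of "2 * p - 2"] by blast
  obtain C2 where C2: "0 < C2" "\<And>n. 2 \<le> n \<Longrightarrow> real n powr (p - 2 + 1) * c n powr p
     \<le> C2 * (\<Sum>k\<in>{(n + 1) div 2..<n}. real k powr (p - 2) * c k powr p)"
    using averaging[of "p - 2"] by blast
  show ?thesis
  proof (rule exI[of _ "1 + C1 + C2"], intro conjI allI impI)
    show "0 < 1 + C1 + C2" using C1 C2 by simp
    fix n J :: nat assume n: "1 \<le> n"
    let ?T = "\<lambda>j. c (n * 2 ^ j) powr p * (real n * 2 ^ j) powr (p - 1)"
    let ?X = "real n powr (- p) * head n"
    have X: "0 \<le> ?X" using head_nonneg by simp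
    have T0: "?T 0 \<le> C1 * ?X + tail n"
    \<comment> \<open>For \<open>n = 1\<close> there are no smaller indices to average over, but
      \<open>c 1 powr p\<close> is itself the first term of the tail.\<close>
    proof (cases "n = 1")
      case True
      have "c 1 powr p \<le> tail 1" using sum_le_tail[of 1 2] by (simp add: numeral_2_eq_2)
      then show ?thesis using True X C1(1) by (simp add: add_increasing)
    next
      case False
      then have n2: "2 \<le> n" using n by simp
      have "real n powr (- p) * (real n powr (2 * p - 2 + 1) * c n powr p)
        \<le> real n powr (- p) * (C1 * (\<Sum>k\<in>{(n + 1) div 2..<n}. real k powr (2 * p - 2) * c k powr p))"
        by (intro mult_left_mono C1 n2) auto
      also have "\<dots> \<le> real n powr (- p) * (C1 * head n)"
        unfolding head_def using C1 n2 by (intro mult_left_mono sum_mono2) auto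
      also have "real n powr (- p) * (real n powr (2 * p - 2 + 1) * c n powr p) = ?T 0"
        by (simp add: mult.assoc[symmetric] powr_add[symmetric])
      finally show ?thesis using tail_nonneg[of n] by (simp add: mult_ac)
    qed
    have "(\<Sum>j<J. ?T j) \<le> (\<Sum>j<Suc J. ?T j)" by simp
    also have "\<dots> \<le> ?T 0 + C2 * (\<Sum>k\<in>{n..<n * 2 ^ J}. real k powr (p - 2) * c k powr p)"
    proof (rule dyadic_averaging)
      fix j
      have "2 \<le> n * 2 ^ Suc j" using n by (simp add: Suc_le_eq)
      from C2(2)[OF this] show "?T (Suc j) \<le> C2 * (\<Sum>k\<in>{n * 2 ^ j..<n * 2 ^ Suc j}. real k powr (p - 2) * c k powr p)"
        by (simp add: mult_ac)
    qed
    also have "\<dots> \<le> (C1 * ?X + tail n) + C2 * tail n"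
      using T0 C2 sum_le_tail by (intro add_mono mult_left_mono) auto
    also have "\<dots> \<le> (1 + C1 + C2) * (?X + tail n)"
      using X tail_nonneg[of n] C1 C2 mult_nonneg_nonneg[of C2 ?X] mult_nonneg_nonneg[of C1 "tail n"]
      by (simp add: distrib_left distrib_right del: mult_nonneg_nonneg)
    finally show "(\<Sum>j<J. ?T j) \<le> (1 + C1 + C2) * (?X + tail n)" .
  qed
qed

text \<open>The block preceding any \<open>2 ^ j < n\<close> with \<open>j > 0\<close> lies below
  \<open>n\<close>, so averaging stays inside \<open>head\<close>; the term \<open>j = 0\<close> is
  the first one of \<open>head\<close>. The exponent \<open>2 * p - 1\<close> is \<open>p\<close>
  from an amplitude proportional to \<open>2 ^ j\<close> plus \<open>p - 1\<close> from the Schur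
  test.\<close>

lemma low_blocks:
  "\<exists>C>0. \<forall>n\<ge>1. \<forall>J. (\<Sum>j<J. if 2 ^ j < n then c (2 ^ j) powr p * (2 ^ j) powr (2 * p - 1) else 0)
     \<le> C * head n"
proof -
  obtain C1 where C1: "0 < C1" "\<And>n. 2 \<le> n \<Longrightarrow> real n powr (2 * p - 2 + 1) * c n powr p
     \<le> C1 * (\<Sum>k\<in>{(n + 1) div 2..<n}. real k powr (2 * p - 2) * c k powr p)"
    using averaging[of "2 * p - 2"] by blast
  show ?thesis
  proof (rule exI[of _ "1 + C1"], intro conjI allI impI)
    show "0 < 1 + C1" using C1 by simp
    fix n J :: nat assume n: "1 \<le> n"
    let ?T = "\<lambda>j. if 2 ^ j < n then c (2 ^ j) powr p * (2 ^ j) powr (2 * p - 1) else 0"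
    let ?f = "\<lambda>k. real k powr (2 * p - 2) * c k powr p"
    \<comment> \<open>Extension by zero beyond \<open>n\<close> lets complete dyadic blocks be
      summed without exceeding \<open>head n\<close>.\<close>
    let ?F = "\<lambda>k. if k < n then ?f k else 0"
    have T0: "?T 0 \<le> head n"
    proof (cases "1 < n")
      case True
      then have "sum ?f {1} \<le> head n" unfolding head_def by (intro sum_mono2) auto
      then show ?thesis using True by simp
    qed (use head_nonneg in auto)
    have "(\<Sum>j<J. ?T j) \<le> (\<Sum>j<Suc J. ?T j)" by simp
    also have "\<dots> \<le> ?T 0 + C1 * (\<Sum>k\<in>{1..<1 * 2 ^ J}. ?F k)"
    proof (rule dyadic_averaging)
      fix j
      have 2: "(2::nat) \<le> 2 ^ Suc j" by (simp add: Suc_le_eq)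
      show "?T (Suc j) \<le> C1 * (\<Sum>k\<in>{1 * 2 ^ j..<1 * 2 ^ Suc j}. ?F k)"
      proof (cases "2 ^ Suc j < n")
        case True
        have "(\<Sum>k\<in>{2 ^ j..<2 ^ Suc j}. ?F k) = (\<Sum>k\<in>{2 ^ j..<2 ^ Suc j}. ?f k)"
          using True by (intro sum.cong) auto
        then show ?thesis using C1(2)[OF 2] True by (simp add: mult_ac)
      next
        case False
        then show ?thesis using C1 by (auto intro!: mult_nonneg_nonneg sum_nonneg)
      qed
    qed
    also have "(\<Sum>k\<in>{1..<1 * 2 ^ J}. ?F k) \<le> head n"
    proof -
      have "(\<Sum>k\<in>{1..<1 * 2 ^ J}. ?F k) = (\<Sum>k\<in>{k\<in>{1..<1 * 2 ^ J}. k < n}. ?f k)"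
        by (subst sum.inter_filter) auto
      also have "\<dots> \<le> head n"
        unfolding head_def by (intro sum_mono2) auto
      finally show ?thesis .
    qed
    finally show "(\<Sum>j<J. ?T j) \<le> (1 + C1) * head n"
      using T0 C1 by (simp add: distrib_right)
  qed
qed

text \<open>Averaging with \<open>s = p - 2\<close> bounds
  \<open>n powr (p - 1) * c n powr p\<close> by part of the convergent series. The rate makes dyadic
  values decay geometrically, which yields pointwise convergence of the cosine series.\<close>

lemma decay: "\<exists>C>0. \<forall>n\<ge>2. c n \<le> C * real n powr (1/p - 1)"
proof -
  obtain C2 where C2: "0 < C2" "\<And>n. 2 \<le> n \<Longrightarrow> real n powr (p - 2 + 1) * c n powr p
     \<le> C2 * (\<Sum>k\<in>{(n + 1) div 2..<n}. real k powr (p - 2) * c k powr p)"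
    using averaging[of "p - 2"] by blast
  define S where "S = C2 * tail 1 + 1"
  have S: "0 < S" using C2 tail_nonneg[of 1] by (simp add: S_def add_nonneg_pos)
  show ?thesis
  proof (rule exI[of _ "S powr (1/p)"], intro conjI allI impI)
    show "0 < S powr (1/p)" using S by simp
    fix n :: nat assume n: "2 \<le> n"
    have "(\<Sum>k\<in>{(n + 1) div 2..<n}. real k powr (p - 2) * c k powr p) \<le> (\<Sum>k\<in>{1..<n}. real k powr (p - 2) * c k powr p)"
      using n by (intro sum_mono2) auto
    also have "\<dots> \<le> tail 1" by (rule sum_le_tail)
    finally have "C2 * (\<Sum>k\<in>{(n + 1) div 2..<n}. real k powr (p - 2) * c k powr p) \<le> C2 * tail 1"
      using C2(1) by (intro mult_left_mono) auto
    then have "real n powr (p - 1) * c n powr p \<le> S"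
      using C2(2)[OF n] unfolding S_def by simp
    then have "(real n powr (p - 1) * c n powr p) powr (1/p) \<le> S powr (1/p)"
      using p by (intro powr_mono2) auto
    moreover have "(real n powr (p - 1) * c n powr p) powr (1/p) = real n powr (1 - 1/p) * c n"
      using p nonneg[of n] n by (simp add: powr_mult powr_powr diff_divide_distrib)
    ultimately have "real n powr (1/p - 1) * (real n powr (1 - 1/p) * c n) \<le> real n powr (1/p - 1) * S powr (1/p)"
      by (intro mult_left_mono) auto
    moreover have "real n powr (1/p - 1) * real n powr (1 - 1/p) = 1"
      using n by (subst powr_add[symmetric]) simp
    ultimately show "c n \<le> S powr (1/p) * real n powr (1/p - 1)"
      by (simp add: mult.assoc[symmetric]) (simp add: mult.commute)
  qed
qed

end

section \<open>Elementary inequalities, Fatou's lemma and null sets\<close>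

lemma abs_sin_diff_le: "\<bar>sin a - sin b\<bar> \<le> \<bar>a - b\<bar>" for a b :: real
proof -
  have "\<bar>sin a - sin b\<bar> = 2 * \<bar>sin ((a - b) / 2)\<bar> * \<bar>cos ((a + b) / 2)\<bar>"
    by (simp add: sin_diff_sin abs_mult)
  also have "\<dots> \<le> 2 * \<bar>(a - b) / 2\<bar> * 1"
    by (intro mult_mono abs_sin_x_le_abs_x) auto
  finally show ?thesis by simp
qed

lemma abs_sum3_powr_le:
  fixes a b c p :: real
  assumes "0 \<le> p"
  shows "\<bar>a + b + c\<bar> powr p \<le> 3 powr p * (\<bar>a\<bar> powr p + \<bar>b\<bar> powr p + \<bar>c\<bar> powr p)"
proof -
  define m where "m = max \<bar>a\<bar> (max \<bar>b\<bar> \<bar>c\<bar>)"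
  have "\<bar>a + b + c\<bar> powr p \<le> (3 * m) powr p"
    using assms by (intro powr_mono2) (auto simp: m_def)
  also have "\<dots> = 3 powr p * m powr p" by (simp add: powr_mult m_def)
  also have "\<dots> \<le> 3 powr p * (\<bar>a\<bar> powr p + \<bar>b\<bar> powr p + \<bar>c\<bar> powr p)"
    by (intro mult_left_mono) (auto simp: m_def max_def)
  finally show ?thesis .
qed

text \<open>Fatou's lemma for almost everywhere limits. The bound is asked only eventually because
  the splitting at frequency \<open>n\<close> requires partial sums of length at least
  \<open>n\<close>.\<close>

lemma nn_integral_le_of_tendsto:
  fixes f :: "nat \<Rightarrow> 'a \<Rightarrow> ennreal"
  assumes [measurable]: "\<And>N. f N \<in> borel_measurable M"
    and lim: "AE x in M. (\<lambda>N. f N x) \<longlonglongrightarrow> g x"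
    and le: "\<forall>\<^sub>F N in sequentially. (\<integral>\<^sup>+x. f N x \<partial>M) \<le> B"
  shows "(\<integral>\<^sup>+x. g x \<partial>M) \<le> B"
proof -
  have "(\<integral>\<^sup>+x. g x \<partial>M) = (\<integral>\<^sup>+x. liminf (\<lambda>N. f N x) \<partial>M)"
    using lim by (intro nn_integral_cong_AE) (auto elim!: eventually_mono simp: lim_imp_Liminf)
  also have "\<dots> \<le> liminf (\<lambda>N. \<integral>\<^sup>+x. f N x \<partial>M)"
    by (intro nn_integral_liminf) auto
  also have "\<dots> \<le> liminf (\<lambda>N::nat. B)"
    using le by (rule Liminf_mono)
  also have "\<dots> = B" by (simp add: Liminf_const)
  finally show ?thesis .
qed

text \<open>The exceptional points, where the kernel bound gives no convergence of the shifted
  series, form a countable set.\<close>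

lemma AE_sin_half_nonzero: "AE x in lborel. sin ((x + h) / 2) \<noteq> (0::real)"
proof -
  have "{x. sin ((x + h) / 2) = 0} \<subseteq> range (\<lambda>i::int. 2 * (of_int i * pi) - h)"
  proof
    fix x assume "x \<in> {x. sin ((x + h) / 2) = 0}"
    then obtain i :: int where "(x + h) / 2 = of_int i * pi"
      by (auto simp: sin_zero_iff_int2)
    then have "x = 2 * (of_int i * pi) - h" by (simp add: field_simps)
    then show "x \<in> range (\<lambda>i::int. 2 * (of_int i * pi) - h)" by blast
  qed
  then have "countable {x. sin ((x + h) / 2) = 0}"
    by (rule countable_subset) auto
  from AE_not_in[OF countable_imp_null_set_lborel[OF this]] show ?thesis by simp
qed

lemma Lp_norm_le:
  assumes "1 < p" and [measurable]: "g \<in> borel_measurable borel" and "0 \<le> B"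
    and le: "(\<integral>\<^sup>+x. ennreal (\<bar>g x\<bar> powr p) * indicator {0..2*pi} x \<partial>lborel) \<le> ennreal B"
  shows "Lp_norm p g \<le> B powr (1/p)"
proof -
  have "(LINT x:{0..2*pi}|lborel. \<bar>g x\<bar> powr p)
      = enn2real (\<integral>\<^sup>+x. ennreal (indicator {0..2*pi} x *\<^sub>R (\<bar>g x\<bar> powr p)) \<partial>lborel)"
    unfolding set_lebesgue_integral_def by (intro integral_eq_nn_integral) auto
  also have "(\<integral>\<^sup>+x. ennreal (indicator {0..2*pi} x *\<^sub>R (\<bar>g x\<bar> powr p)) \<partial>lborel)
      = (\<integral>\<^sup>+x. ennreal (\<bar>g x\<bar> powr p) * indicator {0..2*pi} x \<partial>lborel)"
    by (intro nn_integral_cong) (auto simp: indicator_def)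
  finally have "(LINT x:{0..2*pi}|lborel. \<bar>g x\<bar> powr p) \<le> B"
    using enn2real_leI[OF \<open>0 \<le> B\<close> le] by simp
  moreover have "0 \<le> (LINT x:{0..2*pi}|lborel. \<bar>g x\<bar> powr p)"
    unfolding set_lebesgue_integral_def by (intro integral_nonneg_AE) auto
  ultimately show ?thesis
    unfolding Lp_norm_def using assms(1) by (intro powr_mono2) auto
qed

lemma cos_series_measurable [measurable]: "cos_series c \<in> borel_measurable borel"
  unfolding cos_series_def by measurable

section \<open>Pointwise bounds and convergence of the cosine series\<close>

context gbv_sequence
begin

text \<open>The amplitude \<open>(1 + M) * c (n * 2 ^ j)\<close> dominates both the values on block
  \<open>j\<close>, by \<open>le_doubling\<close>, and their variation. Taking \<open>N\<close>
  blocks is generous, since \<open>N \<le> n * 2 ^ N\<close>; later bounds do not depend on their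
  number.\<close>

lemma cos_partial_sum_le:
  assumes n: "1 \<le> n" and w: "\<bar>w\<bar> \<le> pi * \<bar>sin (x / 2)\<bar>"
  shows "\<bar>\<Sum>k\<in>{n..<N}. c k * cos (real k * x)\<bar>
    \<le> (\<Sum>j<N. (2 * pi * ((1 + M) * c (n * 2 ^ j))) * kern (real n * 2 ^ j) w)"
proof (rule cos_sum_le, rule trig_sum_le[OF _ _ _ _ _ w])
  show "0 < n" using n by simp
  have "N < 2 ^ N" by (rule less_exp)
  then show "N \<le> n * 2 ^ N" using n by (metis less_imp_le mult_le_mono nat_mult_1)
  have pos: "1 \<le> n * 2 ^ j" for j using n by (simp add: Suc_le_eq)
  show "0 \<le> (1 + M) * c (n * 2 ^ j)" for j
    using M nonneg[OF pos] by simp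
  show "\<bar>c k\<bar> \<le> (1 + M) * c (n * 2 ^ j)" if "n * 2 ^ j \<le> k" "k < min (n * 2 ^ Suc j) N" for j k
    using le_doubling[OF pos, of j k] nonneg[of k] pos[of j] that by simp
  show "(\<Sum>k\<in>{n * 2 ^ j..<min (n * 2 ^ Suc j) N - 1}. \<bar>c k - c (Suc k)\<bar>) \<le> (1 + M) * c (n * 2 ^ j)" for j
  proof -
    have "min (n * 2 ^ Suc j) N - 1 \<le> 2 * (n * 2 ^ j) + 1"
      by (rule order_trans[of _ "n * 2 ^ Suc j"]) (simp_all add: le_diff_conv min.coboundedI1 del: power_Suc, simp)
    from variation_le[OF pos this] show ?thesis
      using nonneg[OF pos[of j]] by (simp add: distrib_right)
  qed
qed

text \<open>
  The coefficients are those of the increment over \<open>h\<close> of the low-frequency part, since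
  \<open>cos (k (x + h)) - cos (k x) = - 2 sin (k h / 2) sin (k (x + h / 2))\<close>.
\<close>

lemma sin_partial_sum_le:
  assumes h: "0 < h" and w: "\<bar>w\<bar> \<le> pi * \<bar>sin (x / 2)\<bar>"
  shows "\<bar>\<Sum>k\<in>{1..<n}. (2 * c k * sin (real k * h / 2)) * sin (real k * x)\<bar>
    \<le> (\<Sum>j<n. (2 * pi * (if 2 ^ j < n then 3 * (1 + M) * h * 2 ^ j * c (2 ^ j) else 0)) * kern (1 * 2 ^ j) w)"
proof -
  define a where "a k = 2 * c k * sin (real k * h / 2)" for k
  \<comment> \<open>The sine factor is at most \<open>k * h / 2\<close>, which gives the scale
    \<open>h * 2 ^ j * c (2 ^ j)\<close>; the constant 3 is dictated by the variation bound. Blocks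
    starting at or beyond \<open>n\<close> are empty.\<close>
  define A where "A j = (if 2 ^ j < n then 3 * (1 + M) * h * 2 ^ j * c (2 ^ j) else 0)" for j
  have pos: "1 \<le> (2::nat) ^ j" for j by simp
  have a_le: "\<bar>a k\<bar> \<le> h * real k * c k" if "1 \<le> k" for k
  proof -
    have "\<bar>a k\<bar> = 2 * c k * \<bar>sin (real k * h / 2)\<bar>"
      using nonneg[OF that] by (simp add: a_def abs_mult)
    also have "\<dots> \<le> 2 * c k * \<bar>real k * h / 2\<bar>"
      using nonneg[OF that] by (intro mult_left_mono abs_sin_x_le_abs_x) auto
    finally show ?thesis using h by (simp add: mult_ac)
  qed
  \<comment> \<open>A discrete product rule: one part differences \<open>c\<close>, the other
    differences the sine, which changes by at most \<open>h / 2\<close>.\<close>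
  have diff_le: "\<bar>a k - a (Suc k)\<bar> \<le> h * real k * \<bar>c k - c (Suc k)\<bar> + h * c (Suc k)" for k
  proof -
    have "a k - a (Suc k) = 2 * (c k - c (Suc k)) * sin (real k * h / 2)
       + 2 * c (Suc k) * (sin (real k * h / 2) - sin (real (Suc k) * h / 2))"
      by (simp add: a_def algebra_simps)
    also have "\<bar>\<dots>\<bar> \<le> 2 * \<bar>c k - c (Suc k)\<bar> * \<bar>sin (real k * h / 2)\<bar>
       + 2 * c (Suc k) * \<bar>sin (real k * h / 2) - sin (real (Suc k) * h / 2)\<bar>"
      using nonneg[of "Suc k"]
      by (intro order_trans[OF abs_triangle_ineq]) (simp add: abs_mult del: right_diff_distrib_numeral)
    also have "\<dots> \<le> 2 * \<bar>c k - c (Suc k)\<bar> * \<bar>real k * h / 2\<bar>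
       + 2 * c (Suc k) * \<bar>real k * h / 2 - real (Suc k) * h / 2\<bar>"
      using nonneg[of "Suc k"]
      by (intro add_mono mult_left_mono abs_sin_x_le_abs_x abs_sin_diff_le) auto
    also have "\<bar>real k * h / 2 - real (Suc k) * h / 2\<bar> = h / 2"
      using h by (simp add: field_simps)
    finally show ?thesis using h by (simp add: mult_ac)
  qed
  have "norm (\<Sum>k\<in>{1..<n}. of_real (a k) * cis (real k * x))
    \<le> (\<Sum>j<n. (2 * pi * A j) * kern (real 1 * 2 ^ j) w)"
  proof (rule trig_sum_le[OF _ _ _ _ _ w])
    show "n \<le> 1 * 2 ^ n" using less_exp[of n] by simp
    show "0 \<le> A j" for j
      using M h nonneg[OF pos[of j]] by (simp add: A_def)
    show "\<bar>a k\<bar> \<le> A j" if "1 * 2 ^ j \<le> k" "k < min (1 * 2 ^ Suc j) n" for j k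
    proof -
      have k: "1 \<le> k" using that pos[of j] by linarith
      have k2: "real k \<le> 2 * 2 ^ j"
      proof -
        have "real k \<le> real (2 * 2 ^ j)" using that by (intro of_nat_mono) auto
        then show ?thesis by simp
      qed
      have "\<bar>a k\<bar> \<le> h * real k * c k" by (rule a_le[OF k])
      also have "\<dots> \<le> h * (2 * 2 ^ j) * ((1 + M) * c (2 ^ j))"
        using le_doubling[OF pos, of j k] that h nonneg[OF k] k2
        by (intro mult_mono) auto
      also have "\<dots> \<le> h * (3 * 2 ^ j) * ((1 + M) * c (2 ^ j))"
        using h M nonneg[OF pos[of j]] by (intro mult_mono) auto
      also have "\<dots> = A j" using that by (simp add: A_def)
      finally show ?thesis .
    qed
    show "(\<Sum>k\<in>{1 * 2 ^ j..<min (1 * 2 ^ Suc j) n - 1}. \<bar>a k - a (Suc k)\<bar>) \<le> A j" for j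
    proof (cases "2 ^ j < n")
      case False
      then show ?thesis by (simp add: A_def)
    next
      case True
      define v where "v = min (2 * 2 ^ j) n - 1"
      have v: "v \<le> 2 * 2 ^ j" by (simp add: v_def)
      have cj: "0 \<le> c (2 ^ j)" using nonneg[OF pos] by simp
      have "(\<Sum>k\<in>{2 ^ j..<v}. \<bar>a k - a (Suc k)\<bar>)
        \<le> (\<Sum>k\<in>{2 ^ j..<v}. h * (2 * 2 ^ j) * \<bar>c k - c (Suc k)\<bar> + h * ((1 + M) * c (2 ^ j)))"
      proof (rule sum_mono)
        fix k assume k: "k \<in> {2 ^ j..<v}"
        have k2: "real k \<le> 2 * 2 ^ j"
        proof -
          have "real k \<le> real (2 * 2 ^ j)" using k v by (intro of_nat_mono) auto
          then show ?thesis by simp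
        qed
        have "c (Suc k) \<le> (1 + M) * c (2 ^ j)"
          using k v by (intro le_doubling pos) auto
        then show "\<bar>a k - a (Suc k)\<bar> \<le> h * (2 * 2 ^ j) * \<bar>c k - c (Suc k)\<bar> + h * ((1 + M) * c (2 ^ j))"
          using h k2 nonneg[of "Suc k"] by (intro order_trans[OF diff_le] add_mono mult_mono) auto
      qed
      also have "\<dots> = h * (2 * 2 ^ j) * (\<Sum>k\<in>{2 ^ j..<v}. \<bar>c k - c (Suc k)\<bar>)
          + real (v - 2 ^ j) * (h * ((1 + M) * c (2 ^ j)))"
        by (simp add: sum.distrib sum_distrib_left)
      \<comment> \<open>The variation of \<open>c\<close> contributes \<open>2 * M\<close>; the at
        most \<open>2 ^ j\<close> sine increments contribute \<open>1 + M\<close>. Together they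
        stay below \<open>3 * (1 + M)\<close>.\<close>
      also have "\<dots> \<le> h * (2 * 2 ^ j) * (M * c (2 ^ j)) + 2 ^ j * (h * ((1 + M) * c (2 ^ j)))"
      proof (intro add_mono mult_left_mono mult_right_mono variation_le pos)
        have "real (v - 2 ^ j) \<le> real (2 ^ j)" using v by (intro of_nat_mono) auto
        then show "real (v - 2 ^ j) \<le> 2 ^ j" by simp
      qed (use v h M cj in auto)
      also have "\<dots> = h * 2 ^ j * c (2 ^ j) * (2 * M + (1 + M))" by (simp add: algebra_simps)
      also have "\<dots> \<le> h * 2 ^ j * c (2 ^ j) * (3 * (1 + M))"
        using h cj by (intro mult_left_mono) auto
      also have "\<dots> = A j" using True by (simp add: A_def)
      finally show ?thesis by (simp add: v_def)
    qed
  qed simp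
  then show ?thesis unfolding A_def a_def by (intro sin_sum_le) simp
qed

text \<open>At fixed \<open>x\<close> every kernel is at most \<open>1 / \<bar>w\<bar>\<close>, so a
  section of the series from \<open>n\<close> on is controlled by the sum of the
  \<open>c (n * 2 ^ j)\<close>. By \<open>decay\<close> this is geometric and tends to 0 with
  growing \<open>n\<close>, which is the Cauchy criterion.\<close>

lemma summable_cos_series:
  assumes x: "sin (x / 2) \<noteq> 0"
  shows "summable (\<lambda>n. c (Suc n) * cos (real (Suc n) * x))"
proof -
  obtain C where C: "0 < C" "\<And>n. 2 \<le> n \<Longrightarrow> c n \<le> C * real n powr (1/p - 1)"
    using decay by blast
  define r where "r = 2 powr (1 - 1/p)"
  have r: "1 < r" using p by (simp add: r_def)
  define w where "w = pi * sin (x / 2)"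
  have w: "w \<noteq> 0" "\<bar>w\<bar> \<le> pi * \<bar>sin (x / 2)\<bar>" using x by (auto simp: w_def abs_mult)
  define D where "D = 2 * pi * (1 + M) * C * (r / (r - 1)) / \<bar>w\<bar>"
  have le: "\<bar>\<Sum>k\<in>{n..<N}. c k * cos (real k * x)\<bar> \<le> D * real n powr (1/p - 1)" if n: "2 \<le> n" for n N
  proof -
    have n2: "2 \<le> n * 2 ^ j" for j
    proof -
      have "n * 1 \<le> n * 2 ^ j" by (intro mult_le_mono2) simp
      then show ?thesis using n by linarith
    qed
    have c_nonneg: "0 \<le> c (n * 2 ^ j)" for j
      using order_trans[OF one_le_numeral n2] by (rule nonneg)
    have "\<bar>\<Sum>k\<in>{n..<N}. c k * cos (real k * x)\<bar>
      \<le> (\<Sum>j<N. (2 * pi * ((1 + M) * c (n * 2 ^ j))) * kern (real n * 2 ^ j) w)"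
      using n w by (intro cos_partial_sum_le) auto
    also have "\<dots> \<le> (\<Sum>j<N. (2 * pi * ((1 + M) * (C * (real n powr (1/p - 1) * (1/r) ^ j)))) * (1 / \<bar>w\<bar>))"
    proof (intro sum_mono mult_mono mult_left_mono kern_le_inverse)
      fix j
      have pj: "(2 ^ j) powr (1/p - 1) = (1/r) ^ j"
      proof -
        have "(2 ^ j) powr (1/p - 1) = (2 powr (1/p - 1)) ^ j"
          by (simp add: powr_power powr_powr mult.commute powr_realpow[symmetric])
        also have "2 powr (1/p - 1) = 1 / r"
          using powr_minus_divide[of 2 "1 - 1/p"] by (simp add: r_def)
        finally show ?thesis .
      qed
      show "c (n * 2 ^ j) \<le> C * (real n powr (1/p - 1) * (1/r) ^ j)"
        using C(2)[OF n2[of j]] unfolding pj[symmetric] by (simp add: powr_mult)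
    qed (use n w M C r c_nonneg in \<open>auto intro!: kern_nonneg mult_nonneg_nonneg\<close>)
    also have "\<dots> = 2 * pi * (1 + M) * C * real n powr (1/p - 1) / \<bar>w\<bar> * (\<Sum>j<N. (1/r) ^ j)"
      unfolding sum_distrib_left by (intro sum.cong refl) (simp only: divide_inverse mult_1_left mult_ac)
    also have "\<dots> \<le> 2 * pi * (1 + M) * C * real n powr (1/p - 1) / \<bar>w\<bar> * (r / (r - 1))"
      using M C by (intro mult_left_mono geometric_sum_le r) auto
    also have "\<dots> = D * real n powr (1/p - 1)" by (simp only: D_def divide_inverse mult_ac)
    finally show ?thesis .
  qed
  have "(\<lambda>n. D * real n powr (1/p - 1)) \<longlonglongrightarrow> D * 0"
    using p by (intro tendsto_mult_left tendsto_neg_powr filterlim_real_sequentially) auto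
  then have lim: "(\<lambda>n. D * real n powr (1/p - 1)) \<longlonglongrightarrow> 0" by simp
  show ?thesis
    unfolding summable_Cauchy
  proof (intro allI impI)
    fix e :: real assume "0 < e"
    then have "\<forall>\<^sub>F n in sequentially. D * real n powr (1/p - 1) < e"
      using lim by (rule order_tendstoD(2)[rotated])
    then obtain N0 where N0: "\<And>n. N0 \<le> n \<Longrightarrow> D * real n powr (1/p - 1) < e"
      by (auto simp: eventually_sequentially)
    show "\<exists>N. \<forall>m\<ge>N. \<forall>n. norm (\<Sum>k\<in>{m..<n}. c (Suc k) * cos (real (Suc k) * x)) < e"
    proof (intro exI allI impI)
      \<comment> \<open>After the index shift the sum starts at \<open>Suc m\<close>, which must be
        at least 2 for the decay bound and at least \<open>N0\<close>.\<close>
      fix m n assume m: "N0 + 2 \<le> m"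
      have "(\<Sum>k\<in>{m..<n}. c (Suc k) * cos (real (Suc k) * x)) = (\<Sum>k\<in>{Suc m..<Suc n}. c k * cos (real k * x))"
        by (simp only: sum.shift_bounds_Suc_ivl)
      moreover have "\<bar>\<Sum>k\<in>{Suc m..<Suc n}. c k * cos (real k * x)\<bar> < e"
        using m by (intro le_less_trans[OF le N0]) auto
      ultimately show "norm (\<Sum>k\<in>{m..<n}. c (Suc k) * cos (real (Suc k) * x)) < e" by simp
    qed
  qed
qed

lemma cos_series_lim:
  assumes x: "sin (x / 2) \<noteq> 0"
  shows "(\<lambda>N. \<Sum>k\<in>{1..<N}. c k * cos (real k * x)) \<longlonglongrightarrow> cos_series c x"
proof -
  have "(\<lambda>N. \<Sum>k<N. c (Suc k) * cos (real (Suc k) * x)) \<longlonglongrightarrow> cos_series c x"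
    unfolding cos_series_def by (rule summable_LIMSEQ[OF summable_cos_series[OF x]])
  also have "(\<lambda>N. \<Sum>k<N. c (Suc k) * cos (real (Suc k) * x)) = (\<lambda>N. \<Sum>k\<in>{1..<Suc N}. c k * cos (real k * x))"
    by (simp only: sum.shift_bounds_Suc_ivl One_nat_def atLeast0LessThan[symmetric])
  finally show ?thesis by (rule LIMSEQ_imp_Suc)
qed

end

section \<open>Integral estimates for partial sums and increments\<close>

context gbv_sequence
begin

text \<open>The pointwise kernel bound is integrated by the Schur test, and
  \<open>high_blocks\<close> sums the result. The shift \<open>t\<close> allows the same estimate at
  \<open>x\<close> and at \<open>x + h\<close>; nothing depends on \<open>N\<close>.\<close>

lemma nn_integral_cos_partial_sum:
  "\<exists>C>0. \<forall>n\<ge>1. \<forall>N t. 0 \<le> t \<and> t \<le> 1 \<longrightarrow>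
    (\<integral>\<^sup>+x. ennreal (\<bar>\<Sum>k\<in>{n..<N}. c k * cos (real k * (x + t))\<bar> powr p) * indicator {0..2*pi} x \<partial>lborel)
      \<le> ennreal (C * (real n powr (- p) * head n + tail n))"
proof -
  obtain E where E: "0 < E" and
    EI: "\<And>b (J::nat) A. 0 < b \<Longrightarrow> \<forall>j. 0 \<le> A j \<Longrightarrow>
     (\<integral>\<^sup>+x. ennreal ((\<Sum>j<J. A j * kern (b * 2 ^ j) x) powr p) \<partial>lborel)
       \<le> ennreal (E * (\<Sum>j<J. A j powr p * (b * 2 ^ j) powr (p - 1)))"
    using nn_integral_kern_sum[OF p] by blast
  obtain C where C: "0 < C" and
    CB: "\<And>n J. 1 \<le> n \<Longrightarrow> (\<Sum>j<J. c (n * 2 ^ j) powr p * (real n * 2 ^ j) powr (p - 1))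
     \<le> C * (real n powr (- p) * head n + tail n)"
    using high_blocks by blast
  define K where "K = (2 * pi * (1 + M)) powr p"
  have K: "0 < K" using M by (simp add: K_def add_pos_pos)
  show ?thesis
  proof (rule exI[of _ "2 * (E * (K * C))"], intro conjI allI impI)
    show "0 < 2 * (E * (K * C))" using E K C by simp
    fix n N :: nat and t :: real assume n: "1 \<le> n" and t: "0 \<le> t \<and> t \<le> 1"
    define A where "A j = 2 * pi * ((1 + M) * c (n * 2 ^ j))" for j
    have cj: "0 \<le> c (n * 2 ^ j)" for j
      using n by (intro nonneg) (simp add: Suc_le_eq)
    have A: "0 \<le> A j" for j using cj M by (simp add: A_def)
    have "A j powr p = K * c (n * 2 ^ j) powr p" for j
    proof -
      have "A j = (2 * pi * (1 + M)) * c (n * 2 ^ j)" by (simp add: A_def)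
      then show ?thesis using cj[of j] M unfolding K_def by (simp only: powr_mult)
    qed
    then have "(\<Sum>j<N. A j powr p * (real n * 2 ^ j) powr (p - 1))
       = K * (\<Sum>j<N. c (n * 2 ^ j) powr p * (real n * 2 ^ j) powr (p - 1))"
      by (simp only: sum_distrib_left mult.assoc)
    also have "\<dots> \<le> K * (C * (real n powr (- p) * head n + tail n))"
      using K CB[OF n] by (intro mult_left_mono) auto
    finally have "E * (\<Sum>j<N. A j powr p * (real n * 2 ^ j) powr (p - 1))
       \<le> E * (K * (C * (real n powr (- p) * head n + tail n)))"
      using E by (intro mult_left_mono) auto
    then have R: "(\<integral>\<^sup>+x. ennreal ((\<Sum>j<N. A j * kern (real n * 2 ^ j) x) powr p) \<partial>lborel)
       \<le> ennreal (E * (K * (C * (real n powr (- p) * head n + tail n))))"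
      using n A by (intro order_trans[OF EI] ennreal_leI) auto
    have "(\<integral>\<^sup>+x. ennreal (\<bar>\<Sum>k\<in>{n..<N}. c k * cos (real k * (x + t))\<bar> powr p) * indicator {0..2*pi} x \<partial>lborel)
      \<le> ennreal (2 * (E * (K * (C * (real n powr (- p) * head n + tail n)))))"
      using t n cos_partial_sum_le[OF n] unfolding A_def[symmetric]
      by (intro nn_integral_period_le[where b = "real n" and J = N and A = A and g = "\<lambda>x. \<Sum>k\<in>{n..<N}. c k * cos (real k * x)"] p R A) auto
    then show "(\<integral>\<^sup>+x. ennreal (\<bar>\<Sum>k\<in>{n..<N}. c k * cos (real k * (x + t))\<bar> powr p) * indicator {0..2*pi} x \<partial>lborel)
      \<le> ennreal (2 * (E * (K * C)) * (real n powr (- p) * head n + tail n))"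
      by (simp add: mult.assoc)
  qed
qed

text \<open>The same scheme with \<open>low_blocks\<close>: the amplitudes are proportional to
  \<open>h\<close>, so \<open>h powr p\<close> factors out. The shift is needed for the midpoint
  \<open>x + h / 2\<close>.\<close>

lemma nn_integral_sin_partial_sum:
  "\<exists>C>0. \<forall>n\<ge>1. \<forall>h t. 0 < h \<and> 0 \<le> t \<and> t \<le> 1 \<longrightarrow>
    (\<integral>\<^sup>+x. ennreal (\<bar>\<Sum>k\<in>{1..<n}. (2 * c k * sin (real k * h / 2)) * sin (real k * (x + t))\<bar> powr p)
        * indicator {0..2*pi} x \<partial>lborel)
      \<le> ennreal (C * (h powr p * head n))"
proof -
  obtain E where E: "0 < E" and
    EI: "\<And>b (J::nat) A. 0 < b \<Longrightarrow> \<forall>j. 0 \<le> A j \<Longrightarrow>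
     (\<integral>\<^sup>+x. ennreal ((\<Sum>j<J. A j * kern (b * 2 ^ j) x) powr p) \<partial>lborel)
       \<le> ennreal (E * (\<Sum>j<J. A j powr p * (b * 2 ^ j) powr (p - 1)))"
    using nn_integral_kern_sum[OF p] by blast
  obtain C where C: "0 < C" and
    CB: "\<And>n J. 1 \<le> n \<Longrightarrow> (\<Sum>j<J. if 2 ^ j < n then c (2 ^ j) powr p * (2 ^ j) powr (2 * p - 1) else 0)
     \<le> C * head n"
    using low_blocks by blast
  define K where "K = (2 * pi * 3 * (1 + M)) powr p"
  have K: "0 < K" using M by (simp add: K_def add_pos_pos)
  show ?thesis
  proof (rule exI[of _ "2 * (E * (K * C))"], intro conjI allI impI)
    show "0 < 2 * (E * (K * C))" using E K C by simp
    fix n :: nat and h t :: real assume n: "1 \<le> n" and ht: "0 < h \<and> 0 \<le> t \<and> t \<le> 1"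
    define A where "A j = 2 * pi * (if 2 ^ j < n then 3 * (1 + M) * h * 2 ^ j * c (2 ^ j) else 0)" for j
    have cj: "0 \<le> c (2 ^ j)" for j
      by (intro nonneg) simp
    have A: "0 \<le> A j" for j using cj M ht by (simp add: A_def)
    have "A j powr p * (1 * 2 ^ j) powr (p - 1)
       = K * h powr p * (if 2 ^ j < n then c (2 ^ j) powr p * (2 ^ j) powr (2 * p - 1) else 0)" for j
    proof (cases "2 ^ j < n")
      case True
      have "(2 ^ j :: real) powr (2 * p - 1) = (2 ^ j) powr p * (2 ^ j) powr (p - 1)"
        by (simp add: powr_add[symmetric])
      moreover have "A j = (2 * pi * 3 * (1 + M)) * h * 2 ^ j * c (2 ^ j)"
        using True by (simp add: A_def)
      then have "A j powr p = K * h powr p * (2 ^ j) powr p * c (2 ^ j) powr p"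
        using cj M ht by (simp add: K_def powr_mult)
      ultimately show ?thesis using True by simp
    qed (use p in \<open>simp add: A_def\<close>)
    then have "(\<Sum>j<n. A j powr p * (1 * 2 ^ j) powr (p - 1))
       = K * h powr p * (\<Sum>j<n. if 2 ^ j < n then c (2 ^ j) powr p * (2 ^ j) powr (2 * p - 1) else 0)"
      by (simp only: sum_distrib_left)
    also have "\<dots> \<le> K * h powr p * (C * head n)"
      using K CB[OF n] by (intro mult_left_mono) auto
    finally have "E * (\<Sum>j<n. A j powr p * (1 * 2 ^ j) powr (p - 1)) \<le> E * (K * h powr p * (C * head n))"
      using E by (intro mult_left_mono) auto
    then have R: "(\<integral>\<^sup>+x. ennreal ((\<Sum>j<n. A j * kern (1 * 2 ^ j) x) powr p) \<partial>lborel)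
       \<le> ennreal (E * (K * h powr p * (C * head n)))"
      using A by (intro order_trans[OF EI] ennreal_leI) auto
    have h: "0 < h" using ht by simp
    have "(\<integral>\<^sup>+x. ennreal (\<bar>\<Sum>k\<in>{1..<n}. (2 * c k * sin (real k * h / 2)) * sin (real k * (x + t))\<bar> powr p)
        * indicator {0..2*pi} x \<partial>lborel)
      \<le> ennreal (2 * (E * (K * h powr p * (C * head n))))"
      using ht sin_partial_sum_le[OF h, of _ _ n] unfolding A_def[symmetric]
      by (intro nn_integral_period_le[where b = 1 and J = n and A = A and g = "\<lambda>x. \<Sum>k\<in>{1..<n}. (2 * c k * sin (real k * h / 2)) * sin (real k * x)"] p R A) auto
    then show "(\<integral>\<^sup>+x. ennreal (\<bar>\<Sum>k\<in>{1..<n}. (2 * c k * sin (real k * h / 2)) * sin (real k * (x + t))\<bar> powr p)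
        * indicator {0..2*pi} x \<partial>lborel)
      \<le> ennreal (2 * (E * (K * C)) * (h powr p * head n))"
      by (simp add: mult_ac)
  qed
qed

text \<open>With \<open>n = 1\<close> and \<open>t = 0\<close> all frequencies count as high, and
  Fatou's lemma passes to the limit.\<close>

lemma nn_integral_cos_series_finite:
  "(\<integral>\<^sup>+x. ennreal (\<bar>cos_series c x\<bar> powr p) * indicator {0..2*pi} x \<partial>lborel) < \<infinity>"
proof -
  obtain C where C: "\<And>N. (\<integral>\<^sup>+x. ennreal (\<bar>\<Sum>k\<in>{1..<N}. c k * cos (real k * (x + 0))\<bar> powr p) * indicator {0..2*pi} x \<partial>lborel)
      \<le> ennreal (C * (real 1 powr (- p) * head 1 + tail 1))"
  proof -
    obtain C where "\<And>n N t. 1 \<le> n \<Longrightarrow> 0 \<le> t \<and> t \<le> 1 \<Longrightarrow>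
      (\<integral>\<^sup>+x. ennreal (\<bar>\<Sum>k\<in>{n..<N}. c k * cos (real k * (x + t))\<bar> powr p) * indicator {0..2*pi} x \<partial>lborel)
      \<le> ennreal (C * (real n powr (- p) * head n + tail n))"
      using nn_integral_cos_partial_sum by blast
    from that[OF this[of 1 0]] show ?thesis by simp
  qed
  have "(\<integral>\<^sup>+x. ennreal (\<bar>cos_series c x\<bar> powr p) * indicator {0..2*pi} x \<partial>lborel)
     \<le> ennreal (C * (real 1 powr (- p) * head 1 + tail 1))"
  proof (rule nn_integral_le_of_tendsto)
    show "AE x in lborel. (\<lambda>N. ennreal (\<bar>\<Sum>k\<in>{1..<N}. c k * cos (real k * x)\<bar> powr p) * indicator {0..2*pi} x)
        \<longlonglongrightarrow> ennreal (\<bar>cos_series c x\<bar> powr p) * indicator {0..2*pi} x"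
      using AE_sin_half_nonzero[of 0]
    proof eventually_elim
      case (elim x)
      then show ?case using p cos_series_lim[of x]
        by (auto simp: indicator_def intro!: tendsto_ennrealI tendsto_powr' tendsto_rabs)
    qed
    show "\<forall>\<^sub>F N in sequentially. (\<integral>\<^sup>+x. ennreal (\<bar>\<Sum>k\<in>{1..<N}. c k * cos (real k * x)\<bar> powr p)
        * indicator {0..2*pi} x \<partial>lborel) \<le> ennreal (C * (real 1 powr (- p) * head 1 + tail 1))"
      using C by (intro always_eventually) simp
  qed simp
  also have "\<dots> < \<infinity>" by simp
  finally show ?thesis .
qed

lemma nn_integral_cos_series_diff:
  "\<exists>C>0. \<forall>n\<ge>1. \<forall>h. 0 < h \<and> h \<le> 1 / real n \<longrightarrow>
    (\<integral>\<^sup>+x. ennreal (\<bar>cos_series c (x + h) - cos_series c x\<bar> powr p) * indicator {0..2*pi} x \<partial>lborel)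
      \<le> ennreal (C * (real n powr (- p) * head n + tail n))"
proof -
  obtain C where C: "0 < C" and CI: "\<And>n N t. 1 \<le> n \<Longrightarrow> 0 \<le> t \<and> t \<le> 1 \<Longrightarrow>
    (\<integral>\<^sup>+x. ennreal (\<bar>\<Sum>k\<in>{n..<N}. c k * cos (real k * (x + t))\<bar> powr p) * indicator {0..2*pi} x \<partial>lborel)
      \<le> ennreal (C * (real n powr (- p) * head n + tail n))"
    using nn_integral_cos_partial_sum by blast
  obtain D where D: "0 < D" and DI: "\<And>n h t. 1 \<le> n \<Longrightarrow> 0 < h \<and> 0 \<le> t \<and> t \<le> 1 \<Longrightarrow>
    (\<integral>\<^sup>+x. ennreal (\<bar>\<Sum>k\<in>{1..<n}. (2 * c k * sin (real k * h / 2)) * sin (real k * (x + t))\<bar> powr p)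
        * indicator {0..2*pi} x \<partial>lborel)
      \<le> ennreal (D * (h powr p * head n))"
    using nn_integral_sin_partial_sum by blast
  show ?thesis
  proof (rule exI[of _ "3 powr p * (D + C + C)"], intro conjI allI impI)
    show "0 < 3 powr p * (D + C + C)" using C D by simp
    fix n :: nat and h :: real assume n: "1 \<le> n" and h: "0 < h \<and> h \<le> 1 / real n"
    define Q where "Q = real n powr (- p) * head n + tail n"
    have Q: "0 \<le> Q" using head_nonneg tail_nonneg by (simp add: Q_def)
    have "1 / real n \<le> 1" using n by simp
    then have h1: "h \<le> 1" using h by linarith
    \<comment> \<open>This is where \<open>h \<le> 1 / n\<close> enters: it turns
      \<open>h powr p\<close> into \<open>n powr (- p)\<close>.\<close>
    have hQ: "h powr p * head n \<le> Q"
    proof -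
      have "h powr p \<le> (1 / real n) powr p" using h p by (intro powr_mono2) auto
      also have "\<dots> = real n powr (- p)" using n by (simp add: powr_divide powr_minus field_simps)
      finally have "h powr p * head n \<le> real n powr (- p) * head n"
        by (intro mult_right_mono head_nonneg)
      then show ?thesis using tail_nonneg[of n] by (simp add: Q_def)
    qed
    define S where "S N x = (\<Sum>k\<in>{1..<N}. c k * cos (real k * x))" for N x
    define L where "L x = (\<Sum>k\<in>{1..<n}. (2 * c k * sin (real k * h / 2)) * sin (real k * (x + h / 2)))" for x
    define H where "H N x = (\<Sum>k\<in>{n..<N}. c k * cos (real k * x))" for N x
    have [measurable]: "S N \<in> borel_measurable borel" "L \<in> borel_measurable borel" "H N \<in> borel_measurable borel" for N
      unfolding S_def L_def H_def by measurable
    \<comment> \<open>Below \<open>n\<close> the cosine differences become sines at the midpoint;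
      from \<open>n\<close> on no cancellation between \<open>x + h\<close> and \<open>x\<close> is
      exploited.\<close>
    have split: "S N (x + h) - S N x = - L x + H N (x + h) + - H N x" if "n \<le> N" for N x
    proof -
      have "S N y = (\<Sum>k\<in>{1..<n}. c k * cos (real k * y)) + H N y" for y
        unfolding S_def H_def using n that by (simp add: sum.atLeastLessThan_concat)
      moreover have "(\<Sum>k\<in>{1..<n}. c k * cos (real k * (x + h))) - (\<Sum>k\<in>{1..<n}. c k * cos (real k * x)) = - L x"
        unfolding L_def sum_subtractf[symmetric] sum_negf[symmetric]
      proof (intro sum.cong refl)
        fix k
        have "cos (real k * (x + h)) - cos (real k * x)
          = 2 * sin ((real k * (x + h) + real k * x) / 2) * sin ((real k * x - real k * (x + h)) / 2)"
          by (rule cos_diff_cos)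
        also have "(real k * (x + h) + real k * x) / 2 = real k * (x + h / 2)" by (simp add: field_simps)
        also have "(real k * x - real k * (x + h)) / 2 = - (real k * h / 2)" by (simp add: field_simps)
        finally have "cos (real k * (x + h)) - cos (real k * x)
          = - (2 * sin (real k * (x + h / 2)) * sin (real k * h / 2))" by simp
        then have "c k * (cos (real k * (x + h)) - cos (real k * x))
          = c k * - (2 * sin (real k * (x + h / 2)) * sin (real k * h / 2))" by simp
        then show "c k * cos (real k * (x + h)) - c k * cos (real k * x)
          = - ((2 * c k * sin (real k * h / 2)) * sin (real k * (x + h / 2)))"
          by (simp add: right_diff_distrib mult_ac)
      qed
      ultimately show ?thesis by simp
    qed
    let ?I = "\<lambda>g. \<integral>\<^sup>+x. ennreal (\<bar>g x\<bar> powr p) * indicator {0..2*pi} x \<partial>lborel"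
    have IL: "?I L \<le> ennreal (D * Q)"
      using h h1 hQ D unfolding L_def
      by (intro order_trans[OF DI[OF n]] ennreal_leI mult_left_mono) auto
    have IH: "?I (\<lambda>x. H N (x + t)) \<le> ennreal (C * Q)" if "0 \<le> t" "t \<le> 1" for N t
      using CI[OF n, of t N] that unfolding H_def Q_def by simp
    have bound: "?I (\<lambda>x. S N (x + h) - S N x) \<le> ennreal (3 powr p * (D + C + C) * Q)" if N: "n \<le> N" for N
    proof -
      have "?I (\<lambda>x. S N (x + h) - S N x) \<le> (\<integral>\<^sup>+x. ennreal (3 powr p) *
          (ennreal (\<bar>L x\<bar> powr p) * indicator {0..2*pi} x
           + ennreal (\<bar>H N (x + h)\<bar> powr p) * indicator {0..2*pi} x
           + ennreal (\<bar>H N (x + 0)\<bar> powr p) * indicator {0..2*pi} x) \<partial>lborel)"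
      proof (intro nn_integral_mono)
        fix x
        have "\<bar>S N (x + h) - S N x\<bar> powr p
            \<le> 3 powr p * (\<bar>L x\<bar> powr p + \<bar>H N (x + h)\<bar> powr p + \<bar>H N (x + 0)\<bar> powr p)"
          unfolding split[OF N] using abs_sum3_powr_le[of p "- L x" "H N (x + h)" "- H N x"] p by simp
        then have "ennreal (\<bar>S N (x + h) - S N x\<bar> powr p)
            \<le> ennreal (3 powr p * (\<bar>L x\<bar> powr p + \<bar>H N (x + h)\<bar> powr p + \<bar>H N (x + 0)\<bar> powr p))"
          by (rule ennreal_leI)
        also have "\<dots> = ennreal (3 powr p) * (ennreal (\<bar>L x\<bar> powr p)
           + ennreal (\<bar>H N (x + h)\<bar> powr p) + ennreal (\<bar>H N (x + 0)\<bar> powr p))"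
          by (simp add: ennreal_mult')
        finally show "ennreal (\<bar>S N (x + h) - S N x\<bar> powr p) * indicator {0..2*pi} x \<le> ennreal (3 powr p) *
          (ennreal (\<bar>L x\<bar> powr p) * indicator {0..2*pi} x
           + ennreal (\<bar>H N (x + h)\<bar> powr p) * indicator {0..2*pi} x
           + ennreal (\<bar>H N (x + 0)\<bar> powr p) * indicator {0..2*pi} x)"
          by (cases "x \<in> {0..2*pi}") auto
      qed
      also have "\<dots> = ennreal (3 powr p) * (?I L + ?I (\<lambda>x. H N (x + h)) + ?I (\<lambda>x. H N (x + 0)))"
        by (simp add: nn_integral_cmult nn_integral_add)
      also have "\<dots> \<le> ennreal (3 powr p) * (ennreal (D * Q) + ennreal (C * Q) + ennreal (C * Q))"
        using h h1 by (intro mult_left_mono add_mono IL IH) auto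
      also have "\<dots> = ennreal (3 powr p * (D + C + C) * Q)"
        using C D Q by (simp add: ennreal_plus[symmetric] ennreal_mult'[symmetric] algebra_simps del: ennreal_plus)
      finally show ?thesis .
    qed
    have "?I (\<lambda>x. cos_series c (x + h) - cos_series c x) \<le> ennreal (3 powr p * (D + C + C) * Q)"
    proof (rule nn_integral_le_of_tendsto)
      show "AE x in lborel. (\<lambda>N. ennreal (\<bar>S N (x + h) - S N x\<bar> powr p) * indicator {0..2*pi} x)
          \<longlonglongrightarrow> ennreal (\<bar>cos_series c (x + h) - cos_series c x\<bar> powr p) * indicator {0..2*pi} x"
        \<comment> \<open>Convergence is needed at both \<open>x\<close> and \<open>x + h\<close>,
          so two null sets are removed.\<close>
        using AE_sin_half_nonzero[of 0] AE_sin_half_nonzero[of h]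
      proof eventually_elim
        case (elim x)
        then have "(\<lambda>N. S N (x + h) - S N x) \<longlonglongrightarrow> cos_series c (x + h) - cos_series c x"
          unfolding S_def by (intro tendsto_diff cos_series_lim) auto
        then show ?case using p
          by (auto simp: indicator_def intro!: tendsto_ennrealI tendsto_powr' tendsto_rabs)
      qed
      show "\<forall>\<^sub>F N in sequentially. ?I (\<lambda>x. S N (x + h) - S N x) \<le> ennreal (3 powr p * (D + C + C) * Q)"
        using eventually_ge_at_top[of n] by eventually_elim (rule bound)
    qed simp
    then show "?I (\<lambda>x. cos_series c (x + h) - cos_series c x)
        \<le> ennreal (3 powr p * (D + C + C) * (real n powr (- p) * head n + tail n))"
      by (simp add: Q_def)
  qed
qed

end

section \<open>From integral estimates to the modulus of continuity\<close>

lemma add_powr_le: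
  fixes x y q :: real
  assumes "0 \<le> x" "0 \<le> y" "0 \<le> q" "q \<le> 1"
  shows "(x + y) powr q \<le> 2 * (x powr q + y powr q)"
proof -
  have "(x + y) powr q \<le> (2 * max x y) powr q"
    using assms by (intro powr_mono2) auto
  also have "\<dots> = 2 powr q * max x y powr q" using assms by (simp add: powr_mult)
  also have "\<dots> \<le> 2 powr 1 * (x powr q + y powr q)"
    using assms by (intro mult_mono powr_mono) (auto simp: max_def)
  finally show ?thesis by simp
qed

theorem theorem2p3:
  fixes p :: real and lam :: "nat \<Rightarrow> real"
  assumes "1 < p"
    and "GBV lam"
    and "summable (\<lambda>n. real (Suc n) powr (p - 2) * lam (Suc n) powr p)"
  shows "cos_series lam \<in> borel_measurable lborel \<and>
         set_integrable lborel {0..2*pi} (\<lambda>x. \<bar>cos_series lam x\<bar> powr p) \<and>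
         (\<exists>C>0. \<forall>n::nat\<ge>1.
            Lp_modulus p (cos_series lam) (1 / real n)
              \<le> C * (1 / real n) * (\<Sum>k=1..n-1. real k powr (2*p - 2) * lam k powr p) powr (1/p)
                + C * (\<Sum>k. real (k + n) powr (p - 2) * lam (k + n) powr p) powr (1/p))"
proof -
  obtain M where "0 < M" "\<And>m. 1 \<le> m \<Longrightarrow> (\<Sum>n=m..2*m. \<bar>lam n - lam (Suc n)\<bar>) \<le> M * lam m"
    and "\<And>n. 1 \<le> n \<Longrightarrow> 0 \<le> lam n"
    using \<open>GBV lam\<close> unfolding GBV_def by blast
  then interpret gbv_sequence p M lam
    using assms by unfold_locales auto
  have "cos_series lam \<in> borel_measurable lborel" by simp
  moreover have "set_integrable lborel {0..2*pi} (\<lambda>x. \<bar>cos_series lam x\<bar> powr p)"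
    unfolding set_integrable_def
  proof (rule integrableI_nonneg)
    have "(\<integral>\<^sup>+x. ennreal (indicator {0..2*pi} x *\<^sub>R (\<bar>cos_series lam x\<bar> powr p)) \<partial>lborel)
      = (\<integral>\<^sup>+x. ennreal (\<bar>cos_series lam x\<bar> powr p) * indicator {0..2*pi} x \<partial>lborel)"
      by (intro nn_integral_cong) (auto simp: indicator_def)
    then show "(\<integral>\<^sup>+x. ennreal (indicator {0..2*pi} x *\<^sub>R (\<bar>cos_series lam x\<bar> powr p)) \<partial>lborel) < \<infinity>"
      using nn_integral_cos_series_finite by simp
  qed auto
  moreover have "\<exists>C>0. \<forall>n::nat\<ge>1. Lp_modulus p (cos_series lam) (1 / real n)
      \<le> C * (1 / real n) * head n powr (1/p) + C * tail n powr (1/p)"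
  proof -
    obtain C where C: "0 < C" and CI: "\<And>n h. 1 \<le> n \<Longrightarrow> 0 < h \<and> h \<le> 1 / real n \<Longrightarrow>
      (\<integral>\<^sup>+x. ennreal (\<bar>cos_series lam (x + h) - cos_series lam x\<bar> powr p) * indicator {0..2*pi} x \<partial>lborel)
        \<le> ennreal (C * (real n powr (- p) * head n + tail n))"
      using nn_integral_cos_series_diff by blast
    show ?thesis
    \<comment> \<open>The factor 2 comes from splitting the \<open>p\<close>-th root of a sum by
      \<open>add_powr_le\<close>.\<close>
    proof (rule exI[of _ "2 * C powr (1/p)"], intro conjI allI impI)
      show "0 < 2 * C powr (1/p)" using C by simp
      fix n :: nat assume n: "1 \<le> n"
      let ?X = "real n powr (- p) * head n"
      have X: "0 \<le> ?X" using head_nonneg by simp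
      have "(C * (?X + tail n)) powr (1/p) = C powr (1/p) * (?X + tail n) powr (1/p)"
        using C X tail_nonneg by (simp add: powr_mult)
      also have "\<dots> \<le> C powr (1/p) * (2 * (?X powr (1/p) + tail n powr (1/p)))"
        using X tail_nonneg \<open>1 < p\<close> by (intro mult_left_mono add_powr_le) auto
      also have "?X powr (1/p) = (1 / real n) * head n powr (1/p)"
      proof -
        have "(real n powr (- p)) powr (1/p) = 1 / real n"
          using n \<open>1 < p\<close> unfolding powr_powr by (simp add: powr_minus_divide)
        then show ?thesis using head_nonneg by (simp only: powr_mult powr_ge_zero)
      qed
      finally have B: "(C * (?X + tail n)) powr (1/p)
         \<le> 2 * C powr (1/p) * (1 / real n) * head n powr (1/p) + 2 * C powr (1/p) * tail n powr (1/p)"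
        by (simp add: algebra_simps)
      show "Lp_modulus p (cos_series lam) (1 / real n)
         \<le> 2 * C powr (1/p) * (1 / real n) * head n powr (1/p) + 2 * C powr (1/p) * tail n powr (1/p)"
        unfolding Lp_modulus_def
      proof (rule cSup_least)
        \<comment> \<open>Bounding a supremum by an upper bound needs a nonempty set;
          \<open>h = 1 / real n\<close> is admissible.\<close>
        show "{Lp_norm p (\<lambda>x. cos_series lam (x + h) - cos_series lam x) |h. 0 < h \<and> h \<le> 1 / real n} \<noteq> {}"
          using n by (auto intro!: exI[of _ "1 / real n"])
        fix y assume "y \<in> {Lp_norm p (\<lambda>x. cos_series lam (x + h) - cos_series lam x) |h. 0 < h \<and> h \<le> 1 / real n}"
        then obtain h where h: "0 < h \<and> h \<le> 1 / real n"
          and y: "y = Lp_norm p (\<lambda>x. cos_series lam (x + h) - cos_series lam x)" by auto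
        have "y \<le> (C * (?X + tail n)) powr (1/p)"
          unfolding y using C X tail_nonneg
          by (intro Lp_norm_le \<open>1 < p\<close> CI[OF n h]) auto
        then show "y \<le> 2 * C powr (1/p) * (1 / real n) * head n powr (1/p) + 2 * C powr (1/p) * tail n powr (1/p)"
          using B by simp
      qed
    qed
  qed
  ultimately show ?thesis by (simp add: head_def tail_def)
qed

end
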